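(* Let $G$ be a Hamiltonian maximal planar graph of order at least $4$. Then the total domatic number of $G$ is at least $2$.
   Context: All graphs are finite and simple; the order of a graph is its number of vertices. A maximal planar graph (triangulation) is a planar graph to which no edge can be added on the same vertex set without destroying planarity. A graph is Hamiltonian if it contains a cycle through all its vertices. A set $S\subseteq V(G)$ is a total dominating set of $G$ if every vertex of $G$ (including those in $S$) is adjacent to at least one vertex of $S$. The total domatic number of a graph without isolated vertices is the maximum number of pairwise disjoint total dominating sets in it. *)

theory Defs
  imports "HOL-Analysis.Analysis" "Graph_Theory.Pair_Digraph"
begin

text \<open>
  A finite simple graph is a \<^locale>\<open>pair_graph\<close>: an undirected edge \<open>uv\<close> is represented by
  the two arcs \<open>(u, v)\<close> and \<open>(v, u)\<close>.
\<close>

text \<open>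
  A drawing maps the vertices to distinct points of the plane and every undirected edge \<open>uv\<close> to a
  single simple curve, so the curves are indexed by the two-element set \<open>{u, v}\<close> and carry no
  preferred orientation. A curve meets the vertex points only at its own ends, and two different
  edges meet at most at the points of their common end vertices.
\<close>

definition plane_drawing ::
  "'a pair_pre_digraph \<Rightarrow> ('a \<Rightarrow> complex) \<Rightarrow> ('a set \<Rightarrow> real \<Rightarrow> complex) \<Rightarrow> bool" where
  "plane_drawing G pos \<gamma> \<longleftrightarrow>
     inj_on pos (pverts G) \<and>
     (\<forall>(u, v) \<in> parcs G.
        arc (\<gamma> {u, v}) \<and>
        {pathstart (\<gamma> {u, v}), pathfinish (\<gamma> {u, v})} = {pos u, pos v} \<and>
        path_image (\<gamma> {u, v}) \<inter> pos ` pverts G = {pos u, pos v}) \<and>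
     (\<forall>(u, v) \<in> parcs G. \<forall>(x, y) \<in> parcs G. {u, v} \<noteq> {x, y} \<longrightarrow>
        path_image (\<gamma> {u, v}) \<inter> path_image (\<gamma> {x, y}) \<subseteq> pos ` ({u, v} \<inter> {x, y}))"

definition planar :: "'a pair_pre_digraph \<Rightarrow> bool" where
  "planar G \<longleftrightarrow> (\<exists>pos \<gamma>. plane_drawing G pos \<gamma>)"

definition add_edge :: "'a pair_pre_digraph \<Rightarrow> 'a \<Rightarrow> 'a \<Rightarrow> 'a pair_pre_digraph" where
  "add_edge G u v = G\<lparr>parcs := parcs G \<union> {(u, v), (v, u)}\<rparr>"

definition maximal_planar :: "'a pair_pre_digraph \<Rightarrow> bool" where
  "maximal_planar G \<longleftrightarrow> planar G \<and>
     (\<forall>u \<in> pverts G. \<forall>v \<in> pverts G. u \<noteq> v \<and> (u, v) \<notin> parcs G \<longrightarrow> \<not> planar (add_edge G u v))"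

text \<open>
  \<^const>\<open>pre_digraph.cycle\<close> is the directed notion, under which \<open>u, v, u\<close> is a cycle of a symmetric
  digraph. Requiring at least three arcs leaves exactly the cycles of the undirected graph.
\<close>

definition hamiltonian :: "'a pair_pre_digraph \<Rightarrow> bool" where
  "hamiltonian G \<longleftrightarrow>
     (\<exists>p. pre_digraph.cycle (with_proj G) p \<and> 3 \<le> length p \<and> fst ` set p = pverts G)"

definition total_dominating_set :: "'a pair_pre_digraph \<Rightarrow> 'a set \<Rightarrow> bool" where
  "total_dominating_set G S \<longleftrightarrow>
     S \<subseteq> pverts G \<and> (\<forall>v \<in> pverts G. \<exists>u \<in> S. (v, u) \<in> parcs G)"

text \<open>
  For a finite graph the maximum is over a finite set, since every admissible \<open>F\<close> is a subset of
  \<open>Pow (pverts G)\<close>; the set is nonempty because \<open>F = {}\<close> is admissible.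
\<close>

definition total_domatic_number :: "'a pair_pre_digraph \<Rightarrow> nat" where
  "total_domatic_number G =
     Max {card F |F. (\<forall>S \<in> F. total_dominating_set G S) \<and> pairwise disjnt F}"

end

theory Submission
  imports Defs
begin

text \<open>
Two disjoint total dominating sets are the two classes of a vertex colouring in which every vertex
has neighbours of both colours. Number the vertices along a Hamiltonian cycle by the integers modulo
\<open>n\<close>. The pattern \<open>0011\<close>, repeated around the cycle, gives every vertex two cycle neighbours of
different colours when \<open>4\<close> divides \<open>n\<close>. Otherwise the requirement that the positions \<open>x - 1\<close> and \<open>x + 1\<close>
get different colours for all \<open>x\<close> runs into one odd cycle (\<open>n\<close> odd) or two odd cycles (\<open>n\<close> congruent
to \<open>2\<close>), so one or two vertices are left defective, and a chord at each of them must supply the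
missing colour. Whether a chord can do so depends only on its length modulo \<open>4\<close>, and for
\<open>n\<close> congruent to \<open>2\<close> on the relative position of two chords.

The chords come from planarity. The Hamiltonian cycle is drawn as a Jordan curve, each chord lies
inside or outside, and two chords on the same side cannot have interleaving ends
(\<open>crossing_same_side\<close>). Conversely, two families of chords without interleaving ends can be drawn
above and below a line (\<open>planar_book\<close>). Hence in a maximal planar graph every missing chord is blocked
by a chord of either side, and it follows that each side is a triangulated polygon (\<open>P_triangle\<close>).

It remains to see that two triangulations of the same \<open>n\<close>-gon without common diagonals cannot
consist of useless chords only. For odd \<open>n\<close>, every triangle splits an arc into two arcs whose lengths
add up, and the useless residues do not allow such splittings down to the sides. For \<open>n\<close> congruent to
\<open>2\<close> compare ears, that is chords \<open>{i, i + 2}\<close>: two ears of different parity are useful unless they overlap,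
so all ears have the same parity; then no chord can join two positions of the other parity, so every
such position is the end of a chord of odd length. But a triangulated \<open>n\<close>-gon in
which no length is congruent to \<open>3\<close> has at most \<open>(n - 2) / 4\<close> chords of odd length
(\<open>card_odd_chords\<close>), and twice this number is less than the \<open>n / 2\<close> positions of one parity.
\<close>

section \<open>Two-colourings along a cycle\<close>

text \<open>
Vertices are integers, read modulo \<open>n\<close>: this makes rotations of the cycle plain translations and lets
an arc of the cycle that passes the position \<open>0\<close> be an ordinary interval.
\<close>

definition sees_both :: "int \<Rightarrow> (int \<Rightarrow> int \<Rightarrow> bool) \<Rightarrow> bool" where
  "sees_both n E \<longleftrightarrow> (\<exists>c. (\<forall>x. c (x + n) = c x) \<and> (\<forall>x. \<exists>y z. E x y \<and> E x z \<and> c y \<and> \<not> c z))"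

locale cyclic_graph =
  fixes n :: int and E :: "int \<Rightarrow> int \<Rightarrow> bool"
  assumes n4: "4 \<le> n"
    and per: "E (x + n) y \<longleftrightarrow> E x y"
    and sym: "E x y \<longleftrightarrow> E y x"
    and succ: "E x (x + 1)"
begin

lemma per': "E x (y + n) \<longleftrightarrow> E x y"
  using per sym by metis

lemma complement: "E x (x + d) \<Longrightarrow> E (x + d) (x + d + (n - d))"
  using per'[of "x + d" x] sym[of x "x + d"] by (simp add: algebra_simps)

lemma period_mult: "E (x + n * k) y \<longleftrightarrow> E x y"
proof (induction k rule: int_induct[where k = 0])
  case (step1 i)
  then show ?case using per[of "x + n * i" y] by (simp add: algebra_simps)
next
  case (step2 i)
  then show ?case using per[of "x + n * (i - 1)" y] by (simp add: algebra_simps)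
qed simp

lemma residue: "E (x mod n) y \<longleftrightarrow> E x y"
  using period_mult[of "x mod n" "x div n"] by (simp add: add.commute)

lemma rotate: "cyclic_graph n (\<lambda>x y. E (x + k) (y + k))"
  by unfold_locales
    (use n4 per[of "_ + k"] sym succ[of "_ + k"] in \<open>auto simp: algebra_simps\<close>)

lemma sees_both_rotate:
  assumes "sees_both n (\<lambda>x y. E (x + k) (y + k))"
  shows "sees_both n E"
proof -
  obtain c where c: "\<And>x. c (x + n) = c x"
    "\<And>x. \<exists>y z. E (x + k) (y + k) \<and> E (x + k) (z + k) \<and> c y \<and> \<not> c z"
    using assms unfolding sees_both_def by blast
  have "\<exists>y z. E x y \<and> E x z \<and> c (y - k) \<and> \<not> c (z - k)" for x
  proof -
    obtain y z where "E x (y + k)" "E x (z + k)" "c y" "\<not> c z" using c(2)[of "x - k"] by auto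
    then show ?thesis by (metis add_diff_cancel_right')
  qed
  moreover have "c (x + n - k) = c (x - k)" for x
    using c(1)[of "x - k"] by (simp add: algebra_simps)
  ultimately show ?thesis unfolding sees_both_def by (intro exI[of _ "\<lambda>x. c (x - k)"]) simp
qed

text \<open>
Only the values of \<open>g\<close> on \<open>{0..<n}\<close> matter. At every position either the two cycle neighbours have
different colours, or some other neighbour repairs the defect.
\<close>

lemma sees_bothI:
  fixes g :: "int \<Rightarrow> bool"
  assumes first: "g (n - 1) \<noteq> g 1 \<or> (\<exists>j. 0 \<le> j \<and> j < n \<and> E 0 j \<and> g j \<noteq> g 1)"
    and mid: "\<And>i. 0 < i \<Longrightarrow> i < n - 1 \<Longrightarrow>
      g (i - 1) \<noteq> g (i + 1) \<or> (\<exists>j. 0 \<le> j \<and> j < n \<and> E i j \<and> g j \<noteq> g (i + 1))"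
    and final: "g (n - 2) \<noteq> g 0"
  shows "sees_both n E"
proof -
  have wrap: "E 0 (n - 1)" "E (n - 1) 0"
    using succ[of "n - 1"] per[of 0 "n - 1"] sym by (auto simp: add.commute)
  have "\<exists>y z. E x y \<and> E x z \<and> g (y mod n) \<and> \<not> g (z mod n)" for x
  proof -
    define i where "i = x mod n"
    have i: "0 \<le> i" "i < n" using n4 by (auto simp: i_def)
    let ?p = "if i = 0 then n - 1 else i - 1" and ?q = "if i = n - 1 then 0 else i + 1"
    have nb: "E i ?p" "E i ?q" using wrap succ[of "i - 1"] succ[of i] sym by auto
    have rng: "0 \<le> ?p" "?p < n" "0 \<le> ?q" "?q < n" using i n4 by auto
    have "g ?p \<noteq> g ?q \<or> (\<exists>j. 0 \<le> j \<and> j < n \<and> E i j \<and> g j \<noteq> g ?q)"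
      using first mid[of i] final i n4 by (cases "i = 0"; cases "i = n - 1") auto
    then obtain y z where "E i y" "E i z" "0 \<le> y" "y < n" "0 \<le> z" "z < n" "g y" "\<not> g z"
      using nb rng by blast
    then show ?thesis using residue[of x] unfolding i_def by (metis mod_pos_pos_trivial)
  qed
  then show ?thesis unfolding sees_both_def by (intro exI[of _ "\<lambda>x. g (x mod n)"]) simp
qed

lemma sees_both_0:
  assumes "n mod 4 = 0"
  shows "sees_both n E"
proof (rule sees_bothI[of "\<lambda>k. k mod 4 = 2 \<or> k mod 4 = 3"], goal_cases)
  case 1
  show ?case using assms by (intro disjI1) presburger
next
  case (2 i)
  show ?case by (intro disjI1) presburger
next
  case 3
  show ?case using assms by presburger
qed

text \<open>
For \<open>n\<close> congruent to \<open>1\<close> the pattern \<open>0011\<dots>00110\<close> has a single defect, at the position \<open>0\<close>. A chord of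
length \<open>d\<close> from \<open>0\<close> leads to the missing colour exactly when \<open>d\<close> is congruent to \<open>2\<close> or \<open>3\<close>.
\<close>

lemma sees_both_1_origin:
  assumes "n mod 4 = 1" "E 0 d" "0 < d" "d < n" "d mod 4 = 2 \<or> d mod 4 = 3"
  shows "sees_both n E"
proof (rule sees_bothI[of "\<lambda>k. k mod 4 = 2 \<or> k mod 4 = 3"], goal_cases)
  case 1
  then show ?case using assms by (intro disjI2 exI[of _ d]) auto
next
  case (2 i)
  show ?case by (intro disjI1) presburger
next
  case 3
  then show ?case using assms(1) by presburger
qed

text \<open>
For \<open>n\<close> congruent to \<open>3\<close> the pattern \<open>1001\<dots>1001100\<close> has a single defect at \<open>0\<close>, whose cycle neighbours
are both coloured \<open>0\<close>.
\<close>

lemma sees_both_3_origin: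
  assumes "n mod 4 = 3" "E 0 d" "0 < d" "d < n" "d mod 4 = 0 \<or> d mod 4 = 3"
  shows "sees_both n E"
proof (rule sees_bothI[of "\<lambda>k. k mod 4 = 0 \<or> k mod 4 = 3"], goal_cases)
  case 1
  then show ?case using assms by (intro disjI2 exI[of _ d]) auto
next
  case (2 i)
  show ?case by (intro disjI1) presburger
next
  case 3
  then show ?case using assms(1) by presburger
qed

text \<open>
For \<open>n\<close> congruent to \<open>2\<close> the even and the odd positions form two odd cycles under steps of length \<open>2\<close>,
which are coloured independently. Each of them has two adjacent positions of equal colour, and
the defect is the position between these: here \<open>0\<close> and \<open>d\<close>, which repair each other along the chord.
\<close>

lemma sees_both_2_odd_chord_origin:
  assumes "n mod 4 = 2" "E 0 d" "0 < d" "d < n" "d mod 4 = 3"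
  shows "sees_both n E"
proof (rule sees_bothI[of "\<lambda>k. if odd k then k mod 4 = 3 else if k < d then k mod 4 = 0 else k mod 4 = 2"],
    goal_cases)
  case 1
  have "odd d" using assms(5) by presburger
  then show ?case using assms by (intro disjI2 exI[of _ d]) simp
next
  case (2 i)
  have d: "odd d" using assms(5) by presburger
  consider "i = d" | "i \<noteq> d" "odd i" | "even i" by blast
  then show ?case
  proof cases
    case 1
    have "E d 0" using assms sym by blast
    moreover have "(d + 1) mod 4 = 0" "even (d + 1)" using assms(5) by presburger+
    ultimately show ?thesis using 1 assms by (intro disjI2 exI[of _ 0]) auto
  next
    case 2
    then have "even (i - 1)" "even (i + 1)" "i - 1 < d \<longleftrightarrow> i + 1 < d" using d by presburger+
    moreover have "(i - 1) mod 4 = 0 \<longleftrightarrow> (i + 1) mod 4 \<noteq> 0" "(i - 1) mod 4 = 2 \<longleftrightarrow> (i + 1) mod 4 \<noteq> 2"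
      using 2 by presburger+
    ultimately show ?thesis by simp
  next
    case 3
    then have "odd (i - 1)" "odd (i + 1)" "(i - 1) mod 4 = 3 \<longleftrightarrow> (i + 1) mod 4 \<noteq> 3" by presburger+
    then show ?thesis by simp
  qed
next
  case 3
  have "even (n - 2)" "(n - 2) mod 4 = 0" "\<not> n - 2 < d"
    using assms(1,4,5) by presburger+
  then show ?case using assms(3) by simp
qed

text \<open>
Here the defects are \<open>0\<close> and \<open>q\<close>, and each is repaired by a chord within its own parity class. The
colours that the two chords need fix the relation between the two class colourings; the two demands
agree because both chords have lengths congruent to \<open>2\<close> and span disjoint arcs.
\<close>

lemma sees_both_2_even_chords_origin:
  assumes "n mod 4 = 2" "E 0 2" "E q (q + b)" "odd q" "3 \<le> q" "0 < b" "q + b \<le> n - 1" "b mod 4 = 2"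
  shows "sees_both n E"
proof (rule sees_bothI[of "\<lambda>k. if odd k then k mod 4 = 3 else 0 < k \<and> (if k < q then k mod 4 = 2 else k mod 4 = 0)"],
    goal_cases)
  case 1
  show ?case using assms by (intro disjI2 exI[of _ 2]) auto
next
  case (2 i)
  consider "i = q" | "i \<noteq> q" "odd i" | "even i" by blast
  then show ?case
  proof cases
    case 1
    have "odd (q + b)" "even (q - 1)" "even (q + 1)"  "(q + b) mod 4 = 3 \<longleftrightarrow> (q + 1) mod 4 \<noteq> 0"
      using assms(4,8) by presburger+
    then show ?thesis using 1 assms by (intro disjI2 exI[of _ "q + b"]) auto
  next
    case 2
    have *: "even (i - 1)" "even (i + 1)" "i - 1 < q \<longleftrightarrow> i + 1 < q" using 2 assms(4) by presburger+
    have **: "(i - 1) mod 4 = 0 \<longleftrightarrow> (i + 1) mod 4 \<noteq> 0" "(i - 1) mod 4 = 2 \<longleftrightarrow> (i + 1) mod 4 \<noteq> 2"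
      using 2 by presburger+
    show ?thesis
    proof (cases "i = 1")
      case True
      then show ?thesis using assms(5) by auto
    next
      case False
      then have "0 < i - 1" using \<open>0 < i\<close> by simp
      then show ?thesis using * ** by simp
    qed
  next
    case 3
    then have "odd (i - 1)" "odd (i + 1)" "(i - 1) mod 4 = 3 \<longleftrightarrow> (i + 1) mod 4 \<noteq> 3" by presburger+
    then show ?thesis by simp
  qed
next
  case 3
  have "even (n - 2)" "(n - 2) mod 4 = 0" "\<not> n - 2 < q" "0 < n - 2"
    using assms(1,4-7) by presburger+
  then show ?case by simp
qed

end

lemma (in cyclic_graph) sees_both_1:
  assumes "n mod 4 = 1" "E x (x + d)" "0 < d" "d < n" "d mod 4 = 2 \<or> d mod 4 = 3"
  shows "sees_both n E"
  using cyclic_graph.sees_both_1_origin[OF rotate[of x], of d] assms sees_both_rotate[of x]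
  by (simp add: add.commute)

lemma (in cyclic_graph) sees_both_3:
  assumes "n mod 4 = 3" "E x (x + d)" "0 < d" "d < n" "d mod 4 = 0 \<or> d mod 4 = 3"
  shows "sees_both n E"
  using cyclic_graph.sees_both_3_origin[OF rotate[of x], of d] assms sees_both_rotate[of x]
  by (simp add: add.commute)

lemma (in cyclic_graph) sees_both_2_odd_chord:
  assumes "n mod 4 = 2" "E x (x + d)" "0 < d" "d < n" "d mod 4 = 3"
  shows "sees_both n E"
  using cyclic_graph.sees_both_2_odd_chord_origin[OF rotate[of x], of d] assms sees_both_rotate[of x]
  by (simp add: add.commute)

lemma (in cyclic_graph) sees_both_2_even_chords:
  assumes "n mod 4 = 2" "E x (x + 2)" "E (x + q) (x + q + b)" "odd q" "3 \<le> q" "0 < b" "q + b \<le> n - 1" "b mod 4 = 2"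
  shows "sees_both n E"
  using cyclic_graph.sees_both_2_even_chords_origin[OF rotate[of x], of q b] assms sees_both_rotate[of x]
  by (simp add: add.commute add.left_commute add.assoc)

text \<open>
The arithmetic of the induction step in the count of odd chords: a triangle splits an arc of length
\<open>d\<close> into arcs of lengths \<open>k\<close> and \<open>d - k\<close>, and the bounds for the two parts, together with one more chord
if \<open>d\<close> is odd, add up to the bound for \<open>d\<close>.
\<close>

lemma chord_budget_split:
  fixes d k a b :: int
  assumes "d mod 4 \<noteq> 3" "k mod 4 \<noteq> 3" "(d - k) mod 4 \<noteq> 3"
    and a: "4 * a \<le> k - (if k mod 4 = 0 then 4 else k mod 4)"
    and b: "4 * b \<le> (d - k) - (if (d - k) mod 4 = 0 then 4 else (d - k) mod 4)"
  shows "4 * (a + b + (if odd d then 1 else 0)) \<le> d - (if d mod 4 = 0 then 4 else d mod 4)"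
proof -
  define K where "K = k div 4"
  define L where "L = (d - k) div 4"
  define r where "r = k mod 4"
  define s where "s = (d - k) mod 4"
  have k: "k = 4 * K + r" by (simp add: K_def r_def)
  have "d - k = 4 * L + s" by (simp add: L_def s_def)
  then have d: "d = 4 * K + 4 * L + (r + s)" using k by simp
  then have dm: "d mod 4 = (r + s) mod 4" by presburger
  have par: "odd d \<longleftrightarrow> odd (r + s)" using d by presburger
  have "0 \<le> r" "r < 4" "r \<noteq> 3" "0 \<le> s" "s < 4" "s \<noteq> 3" using assms by (auto simp: r_def s_def)
  then have "r = 0 \<or> r = 1 \<or> r = 2" "s = 0 \<or> s = 1 \<or> s = 2" by auto
  moreover have "(r + s) mod 4 \<noteq> 3" using assms(1) dm by simp
  ultimately show ?thesis
    using a b unfolding dm par r_def[symmetric] s_def[symmetric] unfolding k d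
    by (elim disjE) simp_all
qed

text \<open>
A polygon on the cycle positions together with diagonals that triangulate it. Since \<open>T\<close> is symmetric
and periodic, every chord appears once for each of the two arcs between its ends, so
\<open>triangle\<close> gives the triangles on both sides of it. The sides of the polygon belong to \<open>T\<close>, and their
long arcs have length \<open>n - 1\<close>; applied to these, \<open>triangle\<close> gives the unique triangle at a side.
\<close>

locale polygon = cyclic_graph n T for n T +
  assumes noncrossing: "0 < a \<Longrightarrow> a < d \<Longrightarrow> d < b \<Longrightarrow> b < n \<Longrightarrow> T x (x + d) \<Longrightarrow> \<not> T (x + a) (x + b)"
    and triangle: "2 \<le> d \<Longrightarrow> d < n \<Longrightarrow> T x (x + d) \<Longrightarrow>
      \<exists>k. 0 < k \<and> k < d \<and> T x (x + k) \<and> T (x + k) (x + d)"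
begin

lemma whole: "T x (x + (n - 1))"
  using succ[of "x + n - 1"] per'[of "x+n - 1" x] sym by (simp add: algebra_simps)

lemma ear_in_interval:
  assumes "T x (x + d)" "2 \<le> d" "d < n"
  shows "\<exists>i. x \<le> i \<and> i + 2 \<le> x + d \<and> T i (i + 2)"
  using assms
proof (induction "nat d" arbitrary: x d rule: less_induct)
  case less
  show ?case
  proof (cases "d = 2")
    case True
    then show ?thesis using less.prems by auto
  next
    case False
    obtain k where k: "0 < k" "k < d" "T x (x + k)" "T (x + k) (x + d)"
      using triangle[of d x] less.prems by blast
    show ?thesis
    proof (cases "2 \<le> k")
      case True
      then show ?thesis using less.hyps[of k x] k less.prems by fastforce
    next
      case False
      then have "k = 1" using k by simp
      then obtain i where "x + 1 \<le> i" "i + 2 \<le> x + d" "T i (i + 2)"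
        using less.hyps[of "d - 1" "x + 1"] k less.prems \<open>d \<noteq> 2\<close> by auto
      then show ?thesis by (intro exI[of _ i]) simp
    qed
  qed
qed

text \<open>
If only lengths congruent to \<open>0\<close> and \<open>1\<close> occur, then an arc of length congruent to \<open>0\<close> can only be split
into two such arcs, and this descent does not end.
\<close>

lemma no_edge_of_length_0_mod_4:
  assumes "\<And>x d. 0 < d \<Longrightarrow> d < n \<Longrightarrow> T x (x + d) \<Longrightarrow> d mod 4 = 0 \<or> d mod 4 = 1"
    and "0 < d" "d < n" "d mod 4 = 0"
  shows "\<not> T x (x + d)"
  using assms(2-)
proof (induction "nat d" arbitrary: x d rule: less_induct)
  case less
  show ?case
  proof
    assume "T x (x + d)"
    moreover have "2 \<le> d" using less.prems by presburger
    ultimately obtain k where k: "0 < k" "k < d" "T x (x + k)" "T (x + k) (x + d)"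
      using triangle[of d x] less.prems by blast
    have "k mod 4 = 0 \<or> k mod 4 = 1" using assms(1)[of k x] k less.prems by simp
    moreover have "(d - k) mod 4 = 0 \<or> (d - k) mod 4 = 1"
      using assms(1)[of "d - k" "x + k"] k less.prems by simp
    ultimately have "k mod 4 = 0" using less.prems by presburger
    then show False using less.hyps[of k x] k less.prems by simp
  qed
qed

text \<open>
If only lengths congruent to \<open>1\<close> and \<open>2\<close> occur, then an arc that is split has length congruent to \<open>2\<close>, and
its two parts have lengths congruent to \<open>1\<close>. The parts are therefore not split any further.
\<close>

lemma no_long_edge:
  assumes "\<And>x d. 0 < d \<Longrightarrow> d < n \<Longrightarrow> T x (x + d) \<Longrightarrow> d mod 4 = 1 \<or> d mod 4 = 2"
    and "2 < d" "d < n"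
  shows "\<not> T x (x + d)"
proof -
  have split: "d mod 4 = 2 \<and> k mod 4 = 1 \<and> (d - k) mod 4 = 1"
    if "0 < k" "k < d" "d < n" "T x (x + d)" "T x (x + k)" "T (x + k) (x + d)" for x d k
  proof -
    have "d mod 4 = 1 \<or> d mod 4 = 2" "k mod 4 = 1 \<or> k mod 4 = 2" "(d - k) mod 4 = 1 \<or> (d - k) mod 4 = 2"
      using assms(1)[of d x] assms(1)[of k x] assms(1)[of "d - k" "x + k"] that by auto
    then show ?thesis by presburger
  qed
  have 1: "d mod 4 \<noteq> 1" if "T x (x + d)" "2 \<le> d" "d < n" for x d
    using triangle[OF that(2,3,1)] split[of _ d x] that by auto
  show ?thesis
  proof
    assume T: "T x (x + d)"
    obtain k where k: "0 < k" "k < d" "T x (x + k)" "T (x + k) (x + d)"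
      using triangle[of d x] assms T by auto
    have "k mod 4 = 1" "(d - k) mod 4 = 1" using split[of k d x] k T assms by auto
    then have "\<not> 2 \<le> k" "\<not> 2 \<le> d - k" using 1[of x k] 1[of "x + k" "d - k"] k assms by auto
    then show False using k assms by simp
  qed
qed

text \<open>
The condition \<open>1 < b - a\<close> leaves out the sides of the polygon; the chord \<open>(x, y)\<close> itself is counted.
\<close>

definition odd_chords where
  "odd_chords x y = {(a, b). x \<le> a \<and> b \<le> y \<and> 1 < b - a \<and> odd (b - a) \<and> T a b}"

text \<open>
A side of the polygon has budget \<open>0\<close>. Since lengths congruent to \<open>3\<close> are excluded, odd arcs are split into
lengths congruent to \<open>0\<close> and \<open>1\<close>, and it is the loss of \<open>4\<close> in the part of length congruent to \<open>0\<close>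
that pays for the odd chord itself.
\<close>

lemma card_odd_chords:
  assumes res: "\<And>x d. 0 < d \<Longrightarrow> d < n \<Longrightarrow> T x (x + d) \<Longrightarrow> d mod 4 \<noteq> 3"
    and n: "n mod 4 = 2" and "T x (x + d)" "0 < d" "d < n"
  shows "4 * int (card (odd_chords x (x + d)))
    \<le> d - (if d mod 4 = 0 then 4 else d mod 4)"
  using assms(3-)
proof (induction "nat d" arbitrary: x d rule: less_induct)
  case less
  have fin: "finite (odd_chords x y)" for x y
    by (rule finite_subset[of _ "{x..y} \<times> {x..y}"]) (auto simp: odd_chords_def)
  show ?case
  proof (cases "d = 1")
    case True
    have "1 < b - a \<Longrightarrow> x \<le> a \<Longrightarrow> b \<le> x + 1 \<Longrightarrow> False" for a b by linarith
    then have "odd_chords x (x + d) = {}" unfolding True odd_chords_def by blast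
    then show ?thesis unfolding True by (simp only: card.empty) simp
  next
    case False
    obtain k where k: "0 < k" "k < d" "T x (x + k)" "T (x + k) (x + d)"
      using triangle[of d x] less.prems False by auto
    define self where "self = (if odd d then {(x, x + d)} else {})"
    have "odd_chords x (x + d) \<subseteq> (odd_chords x (x + k) \<union> odd_chords (x + k) (x + d)) \<union> self"
    proof (rule subsetI, rule ccontr)
      fix e
      assume e: "e \<in> odd_chords x (x + d)" "e \<notin> (odd_chords x (x + k) \<union> odd_chords (x + k) (x + d)) \<union> self"
      obtain a b where e_eq: "e = (a, b)" by fastforce
      have ab: "x \<le> a" "b \<le> x + d" "1 < b - a" "odd (b - a)" "T a b" "(a, b) \<notin> self"
          "\<not> x + k \<le> a" "\<not> b \<le> x + k"
        using e unfolding e_eq odd_chords_def by blast+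
      then have b: "x + k < b" "a < x + k" by auto
      \<comment> \<open>A chord that is in neither part and is not the chord of the whole arc would cross a side of the triangle.\<close>
      show False
      proof (cases "a = x")
        case False
        then show False
          using noncrossing[of "a - x" k "b - x" x] ab b k less.prems by auto
      next
        case True
        then have "b \<noteq> x + d" using ab by (auto simp: self_def)
        then show False
          using noncrossing[of "b - (x + k)" "d - k" "n - k" "x + k"] True ab b k less.prems
            per'[of b x] sym[of x b] by (simp add: algebra_simps)
      qed
    qed
    then have "card (odd_chords x (x + d)) \<le> card ((odd_chords x (x + k) \<union> odd_chords (x + k) (x + d)) \<union> self)"
      by (intro card_mono finite_UnI fin) (simp_all add: self_def)
    also have "\<dots> \<le> card (odd_chords x (x + k)) + card (odd_chords (x + k) (x + d)) + card self"
      by (intro order_trans[OF card_Un_le] add_mono card_Un_le order_refl)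
    finally have le: "int (card (odd_chords x (x + d))) \<le>
      int (card (odd_chords x (x + k))) + int (card (odd_chords (x + k) (x + d))) + int (card self)"
      by linarith
    have self: "card self = (if odd d then 1 else 0)" by (simp add: self_def)
    have 1: "4 * int (card (odd_chords x (x + k))) \<le> k - (if k mod 4 = 0 then 4 else k mod 4)"
      using less.hyps[of k x] k less.prems by auto
    have 2: "4 * int (card (odd_chords (x + k) (x + d))) \<le> (d - k) - (if (d - k) mod 4 = 0 then 4 else (d - k) mod 4)"
      using less.hyps[of "d - k" "x + k"] k less.prems by auto
    have "d mod 4 \<noteq> 3" "k mod 4 \<noteq> 3" "(d - k) mod 4 \<noteq> 3"
      using res[of d x] res[of k x] res[of "d - k" "x + k"] k less.prems by auto
    from chord_budget_split[OF this 1 2]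
    have "4 * (int (card (odd_chords x (x + k))) + int (card (odd_chords (x + k) (x + d))) + int (card self))
        \<le> d - (if d mod 4 = 0 then 4 else d mod 4)"
      unfolding self by (simp only: of_nat_0 of_nat_1 if_distrib[of int])
    moreover have "4 * int (card (odd_chords x (x + d)))
        \<le> 4 * (int (card (odd_chords x (x + k))) + int (card (odd_chords (x + k) (x + d))) + int (card self))"
      using le by simp
    ultimately show ?thesis by (rule order_trans[rotated])
  qed
qed

end

text \<open>
The two sides of a Hamiltonian cycle in a triangulation. No chord is drawn on both sides.
\<close>

locale two_polygons =
  fixes n :: int and P :: "bool \<Rightarrow> int \<Rightarrow> int \<Rightarrow> bool"
  assumes polygon: "polygon n (P s)"
    and disjoint: "P True x (x + d) \<Longrightarrow> P False x (x + d) \<Longrightarrow> 0 < d \<Longrightarrow> d < n \<Longrightarrow> d = 1 \<or> d = n - 1"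
begin

sublocale P: polygon n "P s" for s by (rule polygon)

abbreviation E where "E x y \<equiv> \<exists>s. P s x y"

sublocale cyclic_graph n E
  by unfold_locales (use P.n4 P.per P.sym P.succ in auto)

text \<open>
If no colouring exists, then all chords have lengths congruent to \<open>0\<close> or \<open>1\<close> (for \<open>n\<close> congruent to \<open>1\<close>)
respectively \<open>1\<close> or \<open>2\<close> (for \<open>n\<close> congruent to \<open>3\<close>). Each pair of residues is closed under passing from \<open>d\<close>
to \<open>n - d\<close>, so it restricts both arcs of a chord. Both cases fail at the long arc of a side, of length \<open>n - 1\<close>.
\<close>

lemma sees_both_odd:
  assumes "odd n"
  shows "sees_both n E"
proof (rule ccontr)
  assume none: "\<not> ?thesis"
  have "n mod 4 = 1 \<or> n mod 4 = 3" using assms by presburger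
  then show False
  proof
    assume n: "n mod 4 = 1"
    have "d mod 4 = 0 \<or> d mod 4 = 1" if "0 < d" "d < n" "P True x (x + d)" for x d
    proof -
      have "E x (x + d)" using that by blast
      then have "d mod 4 \<noteq> 2 \<and> d mod 4 \<noteq> 3" using sees_both_1[OF n, of x d] that none by auto
      then show ?thesis by presburger
    qed
    then have "\<not> P True 0 (0 + (n - 1))"
      using n n4 by (intro P.no_edge_of_length_0_mod_4) (simp_all, presburger)
    then show False using P.whole by blast
  next
    assume n: "n mod 4 = 3"
    have "d mod 4 = 1 \<or> d mod 4 = 2" if "0 < d" "d < n" "P True x (x + d)" for x d
    proof -
      have "E x (x + d)" using that by blast
      then have "d mod 4 \<noteq> 0 \<and> d mod 4 \<noteq> 3" using sees_both_3[OF n, of x d] that none by auto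
      then show ?thesis by presburger
    qed
    then have "\<not> P True 0 (0 + (n - 1))"
      by (rule P.no_long_edge) (use n n4 in auto)
    then show False using P.whole by blast
  qed
qed

text \<open>
Without a chord at \<open>x\<close> in one polygon, the triangle there joins the neighbours of \<open>x\<close> on the cycle.
This cannot happen in both polygons. In other words, all degrees of the triangulation are at least \<open>3\<close>.
\<close>

lemma chord_at: "\<exists>s d. 1 < d \<and> d < n - 1 \<and> P s x (x + d)"
proof (rule ccontr)
  assume none: "\<not> ?thesis"
  have "P s (x + 1) (x + 1 + (n - 2))" for s
  proof -
    obtain k where k: "0 < k" "k < n - 1" "P s x (x + k)" "P s (x + k) (x + (n - 1))"
      using P.triangle[of "n - 1" s x] P.whole[of s x] n4 by auto
    then have "\<not> 1 < k" using none by blast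
    then have "k = 1" using k by simp
    then show ?thesis using k by (simp add: algebra_simps)
  qed
  then have "n - 2 = 1 \<or> n - 2 = n - 1" using disjoint[of "x + 1" "n - 2"] n4 by auto
  then show False using n4 by simp
qed

end

text \<open>
The hardest residue. In the absence of a colouring, no chord has length congruent to \<open>3\<close> (\<open>odd_chord\<close>), and
an ear is in conflict with many chords of the other parity (\<open>even_chords\<close>). The ears then
all have one parity (\<open>same\<close>), chords of even length on the other parity class are
impossible (\<open>no_even\<close>), and finally the count of odd chords is too small.
\<close>

lemma (in two_polygons) sees_both_2:
  assumes n2: "n mod 4 = 2"
  shows "sees_both n E"
proof (rule ccontr)
  assume none: "\<not> ?thesis"
  have n6: "6 \<le> n" using n2 n4 by presburger
  have odd_chord: "d mod 4 \<noteq> 3" if "P s x (x + d)" "0 < d" "d < n" for s x d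
    using sees_both_2_odd_chord[OF n2, of x d] that none by blast
  have even_chords: False
    if "P s x (x + 2)" "P t (x + q) (x + q + b)" "odd q" "3 \<le> q" "0 < b" "q + b \<le> n - 1" "b mod 4 = 2"
    for s t x q b
    using sees_both_2_even_chords[OF n2, of x q b] that none by blast
  \<comment> \<open>Two ears of different parity overlap: the starting positions are neighbours on the cycle.\<close>
  have near: "j - i = 1 \<or> j - i = n - 1"
    if "P s i (i + 2)" "P t j (j + 2)" "odd (j - i)" "0 < j - i" "j - i < n" for s t i j
  proof (rule ccontr)
    assume "\<not> ?thesis"
    moreover have "j - i \<noteq> 2" "j - i \<noteq> n - 2" using that n2 by presburger+
    ultimately have "3 \<le> j - i" "j - i + 2 \<le> n - 1" using that by auto
    then show False using even_chords[of s i t "j - i" 2] that by simp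
  qed
  have opposite: "s \<noteq> t"
    if "P s i (i + 2)" "P t (i + 1) (i + 1 + 2)" for s t i
  proof
    assume "s = t"
    then have "P s (i + 1) (i + 3)" using that(2) by (simp add: add.assoc)
    then show False using P.noncrossing[of 1 2 3 s i] that(1) n6 by simp
  qed
  \<comment> \<open>The complementary arc of an ear contains an ear of the same polygon.\<close>
  have another: "\<exists>j. i + 2 \<le> j \<and> j + 2 \<le> i + n \<and> P s j (j + 2)" if "P s i (i + 2)" for s i
  proof -
    have "P s (i + 2) (i + 2 + (n - 2))" using that P.complement by blast
    from P.ear_in_interval[OF this] n6 show ?thesis by (auto simp: algebra_simps)
  qed
  \<comment> \<open>Overlapping ears lie in different polygons. Each polygon has a second ear, which must overlap the ears of the other polygon, and these requirements clash.\<close>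
  have consecutive: False if i: "P s i (i + 2)" and j: "P t (i + 1) (i + 1 + 2)" for s t i
  proof -
    have "s \<noteq> t" using opposite that by blast
    obtain i' where i': "i + 2 \<le> i'" "i' + 2 \<le> i + n" "P s i' (i' + 2)"
      using another[OF i] by blast
    obtain j' where j': "i + 3 \<le> j'" "j' + 1 \<le> i + n" "P t j' (j' + 2)"
      using another[OF j] by (auto simp: algebra_simps)
    have "even (i' - i)"
    proof (rule ccontr)
      assume "odd (i' - i)"
      then have "i' - i = 1 \<or> i' - i = n - 1" using near[OF i i'(3)] i' by auto
      then show False using i' by auto
    qed
    then have "odd (i' - (i + 1))" by simp
    then have "i' - (i + 1) = 1 \<or> i' - (i + 1) = n - 1" using near[OF j i'(3)] i' n6 by auto
    then have i'_eq: "i' = i + 2" using i' by auto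
    have "even (j' - (i + 1))"
    proof (rule ccontr)
      assume "odd (j' - (i + 1))"
      then have "j' - (i + 1) = 1 \<or> j' - (i + 1) = n - 1" using near[OF j j'(3)] j' by auto
      then show False using j' by auto
    qed
    then have "odd (j' - i)" "odd (j' - (i + 2))" by simp_all
    then have "j' - i = 1 \<or> j' - i = n - 1" "j' - (i + 2) = 1 \<or> j' - (i + 2) = n - 1"
      using near[OF i j'(3)] near[OF i'(3) j'(3)] j' i'_eq by auto
    then show False using j' n6 by auto
  qed
  \<comment> \<open>Shift the second ear by a multiple of \<open>n\<close> so that it starts at most \<open>n - 1\<close> after the first.\<close>
  have same: "even (j - i)" if i: "P s i (i + 2)" and j: "P t j (j + 2)" for s t i j
  proof (rule ccontr)
    assume odd: "odd (j - i)"
    define k where "k = (j - i) div n"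
    define j' where "j' = i + (j - i) mod n"
    have j': "P t j' (j' + 2)"
    proof -
      have j_eq: "j = j' + n * k" by (simp add: j'_def k_def)
      show ?thesis using j unfolding j_eq
        using P.period_mult[of t j' k] P.period_mult[of t "j' + 2" k] P.sym
        by (metis add.assoc add.commute)
    qed
    have "even n" using n2 by presburger
    then have odd': "odd (j' - i)" using odd by (simp add: j'_def dvd_mod_iff)
    have "0 \<le> j' - i" "j' - i < n" using n4 by (auto simp: j'_def)
    moreover have "j' - i \<noteq> 0" using odd' by auto
    ultimately have "j' - i = 1 \<or> j' - i = n - 1" using near[OF i j'] odd' by auto
    then show False
    proof
      assume "j' - i = 1"
      then have "j' = i + 1" by simp
      then show False using consecutive[OF i, of t] j' by simp
    next
      assume "j' - i = n - 1"
      then have "j' = i - 1 + n" by simp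
      then have "P t (i - 1) (i - 1 + n + 2)" using j' P.per by simp
      moreover have "i - 1 + n + 2 = i - 1 + 2 + n" by simp
      ultimately have "P t (i - 1) (i - 1 + 2)" using P.per' by simp
      then show False using consecutive[of t "i - 1" s] i by simp
    qed
  qed
  obtain r s0 where r: "P s0 r (r + 2)"
    using P.ear_in_interval[OF P.whole] n6 by fastforce
  \<comment> \<open>One of the two arcs of such a chord has length congruent to \<open>2\<close>. The other arc contains an ear of the same polygon, and its parity makes the ear and the chord useful together.\<close>
  have no_even: False if "P s x (x + d)" "odd (x - r)" "even d" "0 < d" "d < n" for s x d
  proof -
    have aux: False if "P s x (x + d)" "odd (x - r)" "d mod 4 = 2" "0 < d" "d < n" for x d
    proof -
      have "d \<noteq> n - 1" "d \<noteq> n - 2" "d \<noteq> n - 3" using that n2 by presburger+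
      then have "d + 4 \<le> n" using that by auto
      have "P s (x + d) (x + d + (n - d))" using that P.complement by blast
      then obtain i where i: "x + d \<le> i" "i + 2 \<le> x + n" "P s i (i + 2)"
        using P.ear_in_interval[of s "x + d" "n - d"] \<open>d + 4 \<le> n\<close> \<open>0 < d\<close> by auto
      have "even (i - r)" using same[OF r i(3)] .
      then have "odd (x - i)" using \<open>odd (x - r)\<close> by presburger
      moreover have "even d" "even n" using that n2 by presburger+
      ultimately have "i \<noteq> x + d" "i \<noteq> x + n - 2" "odd (x + n - i)" by auto
      then have "x + d + 1 \<le> i" "i + 3 \<le> x + n" using i by auto
      moreover have "P s (x + n) (x + d + n)" using that P.per P.per' by simp
      then have "P s (i + (x + n - i)) (i + (x + n - i) + d)" by (simp add: add.commute add.left_commute)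
      ultimately show False
        using even_chords[OF i(3), of s "x + n - i" d] \<open>odd (x + n - i)\<close> that by auto
    qed
    have "d mod 4 = 2 \<or> (n - d) mod 4 = 2" using \<open>even d\<close> n2 by presburger
    then show False
    proof
      assume "d mod 4 = 2" then show False using aux that by blast
    next
      assume "(n - d) mod 4 = 2"
      moreover have "P s (x + d) (x + d + (n - d))" using that P.complement by blast
      moreover have "odd (x + d - r)" using that by presburger
      ultimately show False using aux[of "x + d" "n - d"] that by auto
    qed
  qed
  define C where "C s = P.odd_chords s r (r + (n - 1))" for s
  have C_le: "4 * int (card (C s)) \<le> n - 2" for s
  proof -
    have "(n - 1) mod 4 = 1" using n2 by presburger
    then show ?thesis
      using P.card_odd_chords[of s r "n - 1", OF odd_chord n2 P.whole] n6 unfolding C_def by auto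
  qed
  have fin: "finite (C s)" for s
    by (rule finite_subset[of _ "{r..r+n} \<times> {r..r+n}"]) (auto simp: C_def P.odd_chords_def)
  \<comment> \<open>The end of an odd chord that has the parity opposite to \<open>r\<close>.\<close>
  define h where "h = (\<lambda>(a, b). if odd (a - r) then a else b)"
  define V where "V = {x \<in> {r..r + (n - 1)}. odd (x - r)}"
  have "V \<subseteq> h ` (C True \<union> C False)"
  proof
    fix x assume "x \<in> V"
    then have x: "r \<le> x" "x \<le> r + (n - 1)" "odd (x - r)" by (auto simp: V_def)
    obtain s d where d: "1 < d" "d < n - 1" "P s x (x + d)" using chord_at by blast
    have odd: "odd d" using no_even[OF d(3)] x d by auto
    show "x \<in> h ` (C True \<union> C False)"
    proof (cases "x + d \<le> r + (n - 1)")
      case True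
      then have "(x, x + d) \<in> C s" "h (x, x + d) = x" using x d odd by (auto simp: C_def P.odd_chords_def h_def)
      then show ?thesis by (cases s) force+
    next
      case False
      have "P s (x + d - n) x" using d P.per[of s "x + d - n" x] P.sym by simp
      moreover have "even n" using n2 by presburger
      then have "odd (x - (x + d - n))" "even (x + d - n - r)" using odd x by auto
      ultimately have "(x + d - n, x) \<in> C s" "h (x + d - n, x) = x"
        using x d False by (auto simp: C_def P.odd_chords_def h_def)
      then show ?thesis by (cases s) force+
    qed
  qed
  then have "card V \<le> card (C True \<union> C False)"
    using fin by (meson card_image_le card_mono finite_UnI finite_imageI order_trans)
  also have "\<dots> \<le> card (C True) + card (C False)" by (rule card_Un_le)
  finally have "4 * int (card V) \<le> 2 * n - 4" using C_le[of True] C_le[of False] by linarith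
  moreover have "int (card V) = n div 2"
  proof -
    have "V = (\<lambda>k. r + 2 * k + 1) ` {0..<n div 2}"
    proof (intro set_eqI iffI)
      fix x assume "x \<in> V"
      then have "x = r + 2 * ((x - r) div 2) + 1" "(x - r) div 2 \<in> {0..<n div 2}"
        using n2 by (auto simp: V_def; presburger)+
      then show "x \<in> (\<lambda>k. r + 2 * k + 1) ` {0..<n div 2}" by blast
    qed (use n2 in \<open>auto simp: V_def; presburger\<close>)
    moreover have "inj_on (\<lambda>k. r + 2 * k + 1) {0..<n div 2}" by (auto intro: inj_onI)
    ultimately show ?thesis using n6 by (simp add: card_image)
  qed
  ultimately show False using n2 by presburger
qed

lemma (in two_polygons) sees_both_two_polygons: "sees_both n E"
proof -
  have "n mod 4 = 0 \<or> odd n \<or> n mod 4 = 2" by presburger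
  then show ?thesis by (elim disjE sees_both_0 sees_both_odd sees_both_2)
qed

section \<open>Maximal pairs of noncrossing chord families\<close>

text \<open>
The combinatorial content of planarity and maximality: chords on the same page do not interleave, and a
missing chord cannot be added to either page because that page holds a chord interleaving with it.
\<close>

locale maximal_book = cyclic_graph n E for n E +
  fixes page :: "int \<Rightarrow> int \<Rightarrow> bool"
  assumes page_per: "page (x + n) y \<longleftrightarrow> page x y"
    and page_sym: "page x y \<longleftrightarrow> page y x"
    and crossing: "0 < a \<Longrightarrow> a < d \<Longrightarrow> d < b \<Longrightarrow> b < n \<Longrightarrow> E x (x + d) \<Longrightarrow> E (x + a) (x + b) \<Longrightarrow>
      page x (x + d) \<noteq> page (x + a) (x + b)"
    and blocked: "0 < d \<Longrightarrow> d < n \<Longrightarrow> \<not> E x (x + d) \<Longrightarrow>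
      \<exists>a b. 0 < a \<and> a < d \<and> d < b \<and> b < n \<and> E (x + a) (x + b) \<and> page (x + a) (x + b) = s"
begin

text \<open>
The sides of the polygon belong to both pages, whatever page they are assigned to.
\<close>

definition P :: "bool \<Rightarrow> int \<Rightarrow> int \<Rightarrow> bool" where
  "P s x y \<longleftrightarrow> E x y \<and> ((y - x) mod n \<in> {1, n - 1} \<or> page x y = s)"

lemma P_chord:
  assumes "1 < d" "d < n - 1"
  shows "P s x (x + d) \<longleftrightarrow> E x (x + d) \<and> page x (x + d) = s"
proof -
  have "d mod n = d" using assms by simp
  then show ?thesis using assms by (auto simp: P_def)
qed

lemma P_chord':
  assumes "1 < b - a" "b - a < n - 1"
  shows "P s (x + a) (x + b) \<longleftrightarrow> E (x + a) (x + b) \<and> page (x + a) (x + b) = s"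
  using P_chord[of "b - a" s "x + a"] assms by simp

lemma P_noncrossing:
  assumes "0 < a" "a < d" "d < b" "b < n" "P s x (x + d)"
  shows "\<not> P s (x + a) (x + b)"
proof -
  have "1 < d" "d < n - 1" "1 < b - a" "b - a < n - 1" using assms by auto
  then show ?thesis using crossing[of a d b x] P_chord[of d s x] P_chord'[of b a s x] assms by blast
qed

lemma P_cyclic: "cyclic_graph n (P s)"
proof
  show "P s (x + n) y \<longleftrightarrow> P s x y" for x y
  proof -
    have "(y - (x + n)) mod n = (y - x) mod n"
      using mod_add_self2[of "y - (x + n)" n] by (simp add: algebra_simps)
    then show ?thesis by (simp add: P_def per page_per)
  qed
  show "P s x y \<longleftrightarrow> P s y x" for x y
  proof -
    have *: "(y - x) mod n \<in> {1, n - 1} \<Longrightarrow> (x - y) mod n \<in> {1, n - 1}" for x y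
      using zmod_zminus1_eq_if[of "y - x" n] n4 by (auto split: if_splits)
    show ?thesis using *[of x y] *[of y x] sym[of x y] page_sym[of x y] by (auto simp: P_def)
  qed
  show "P s x (x + 1)" for x using succ n4 by (simp add: P_def)
qed (rule n4)

sublocale P: cyclic_graph n "P s" for s by (rule P_cyclic)

text \<open>
Let \<open>k\<close> be the last position before \<open>d\<close> joined to \<open>x\<close>, seen from the page \<open>s\<close>. Nothing on the page
separates \<open>x + k\<close> from \<open>x + d\<close>, so they are adjacent. If this edge lies on the page, the triangle is
found. If it lies on the other page, then let \<open>j\<close> be the last position before \<open>d\<close> joined to \<open>x + k\<close>. Again
\<open>x\<close> and \<open>x + j\<close> are not separated, hence adjacent, and this edge must be on the page \<open>s\<close>, because on
the other page it would cross the edge from \<open>x + k\<close> to \<open>x + d\<close>. This contradicts the choice of \<open>k\<close>.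
\<close>

lemma P_triangle:
  assumes d: "2 \<le> d" "d < n" and T: "P s x (x + d)"
  shows "\<exists>k. 0 < k \<and> k < d \<and> P s x (x + k) \<and> P s (x + k) (x + d)"
proof -
  define K where "K = {k. 0 < k \<and> k < d \<and> P s x (x + k)}"
  have finK: "finite K" by (rule finite_subset[of _ "{0..d}"]) (auto simp: K_def)
  have "1 \<in> K" using d P.succ by (simp add: K_def)
  define k where "k = Max K"
  have "k \<in> K" using finK \<open>1 \<in> K\<close> unfolding k_def by (metis Max_in empty_iff)
  then have k: "0 < k" "k < d" "P s x (x + k)" by (auto simp: K_def)
  have k_max: "\<not> P s x (x + c)" if "k < c" "c < d" for c
    using Max_ge[OF finK, of c] that k unfolding k_def K_def by fastforce
  show ?thesis
  proof (cases "P s (x + k) (x + d)")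
    case True
    then show ?thesis using k by blast
  next
    case not_s: False
    have "d - k \<noteq> 1"
    proof
      assume "d - k = 1"
      then have "x + d = x + k + 1" by simp
      then show False using not_s P.succ[of s "x + k"] by argo
    qed
    then have dk: "1 < d - k" "d - k < n - 1" using k d by auto
    have E1: "E (x + k) (x + d)"
    proof (rule ccontr)
      assume "\<not> E (x + k) (x + d)"
      then obtain a b where ab: "0 < a" "a < d - k" "d - k < b" "b < n"
        "E (x + k + a) (x + k + b)" "page (x + k + a) (x + k + b) = s"
        using blocked[of "d - k" "x + k" s] k d by auto
      then have T2: "P s (x + (k + a)) (x + (k + b))"
        by (simp add: P_def add.assoc)
      consider "k + b < n" | "k + b = n" | "k + b > n" by linarith
      then show False
      proof cases
        case 1
        then show False using P_noncrossing[of "k + a" d "k + b" s x] T T2 ab k by auto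
      next
        case 2
        then have "P s x (x + (k + a))" using T2 P.per'[of s "x + (k + a)" x] P.sym by simp
        then show False using k_max[of "k + a"] ab by auto
      next
        case 3
        have "P s (x + (k + b - n)) (x + (k + a))"
          using T2 P.per[of s "x + (k + b - n)" "x + (k + a)"] P.sym[of s "x + (k + a)"] by (simp add: algebra_simps)
        then show False
          using P_noncrossing[of "k + b - n" k "k + a" s x] 3 ab k d by auto
      qed
    qed
    then have page1: "page (x + k) (x + d) = (\<not> s)" using not_s P_chord'[OF dk] by auto
    define J where "J = {j. k < j \<and> j < d \<and> P s (x + k) (x + j)}"
    have finJ: "finite J" by (rule finite_subset[of _ "{0..d}"]) (use k in \<open>auto simp: J_def\<close>)
    have "k + 1 \<in> J" using dk P.succ[of s "x + k"] by (simp add: J_def add.assoc)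
    define j where "j = Max J"
    have "j \<in> J" using finJ \<open>k + 1 \<in> J\<close> unfolding j_def by (metis Max_in empty_iff)
    then have j: "k < j" "j < d" "P s (x + k) (x + j)" by (auto simp: J_def)
    have j_max: "\<not> P s (x + k) (x + c)" if "j < c" "c < d" for c
      using Max_ge[OF finJ, of c] that j unfolding j_def J_def by fastforce
    have Tkj: "P s (x + k) (x + k + (j - k))" using j by simp
    have E2: "E x (x + j)"
    proof (rule ccontr)
      assume "\<not> E x (x + j)"
      then obtain a b where ab: "0 < a" "a < j" "j < b" "b < n" "E (x + a) (x + b)" "page (x + a) (x + b) = s"
        using blocked[of j x s] j k d by auto
      then have T2: "P s (x + a) (x + b)" by (simp add: P_def)
      have "\<not> d < b" using P_noncrossing[of a d b s x] T T2 ab j by auto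
      moreover have "\<not> a < k" using P_noncrossing[of a k b s x] T2 k ab j by auto
      moreover have "a \<noteq> k" using T2 not_s j_max[of b] ab \<open>\<not> d < b\<close> by (cases "b = d") auto
      moreover have "\<not> k < a" using P_noncrossing[of "a - k" "j - k" "b - k" s "x + k"] Tkj T2 ab k j by auto
      ultimately show False by linarith
    qed
    have "page x (x + j) = s" using crossing[of k j d x] page1 E1 E2 j k d by auto
    then have "P s x (x + j)" using E2 by (simp add: P_def)
    then show ?thesis using k_max[of j] j by auto
  qed
qed

lemma P_polygon: "polygon n (P s)"
  by unfold_locales (use P_noncrossing P_triangle in blast)+

sublocale polygons: two_polygons n P
proof (rule two_polygons.intro)
  show "polygon n (P s)" for s by (rule P_polygon)
  show "d = 1 \<or> d = n - 1" if "P True x (x + d)" "P False x (x + d)" "0 < d" "d < n" for x d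
    using that P_chord[of d _ x] by (cases "d = 1"; cases "d = n - 1") auto
qed

theorem graph_sees_both: "sees_both n E"
proof -
  obtain c where c: "\<And>x. c (x + n) = c x"
    "\<And>x. \<exists>y z. (\<exists>s. P s x y) \<and> (\<exists>s. P s x z) \<and> c y \<and> \<not> c z"
    using polygons.sees_both_two_polygons unfolding sees_both_def by blast
  have "\<exists>y z. E x y \<and> E x z \<and> c y \<and> \<not> c z" for x
    using c(2)[of x] unfolding P_def by blast
  then show ?thesis unfolding sees_both_def using c(1) by blast
qed

end

section \<open>Drawing two noncrossing chord families\<close>

text \<open>
The vertices are placed on the real axis. The curve from \<open>a\<close> to \<open>b\<close> is the graph of \<open>s (x - a) (b - x)\<close>, a
parabola above or below the axis according to the sign \<open>s\<close>. As all parabolas have the same leading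
coefficient up to sign, nested intervals give nested curves.
\<close>

definition book_curve :: "real \<Rightarrow> real \<Rightarrow> real \<Rightarrow> real \<Rightarrow> complex" where
  "book_curve s a b t = (let x = a + t * (b - a) in Complex x (s * ((x - a) * (b - x))))"

lemma path_image_book_curve:
  assumes "a < b"
  shows "z \<in> path_image (book_curve s a b) \<longleftrightarrow>
    a \<le> Re z \<and> Re z \<le> b \<and> Im z = s * ((Re z - a) * (b - Re z))"
proof
  assume "z \<in> path_image (book_curve s a b)"
  then obtain t where t: "0 \<le> t" "t \<le> 1" "z = book_curve s a b t" by (auto simp: path_image_def)
  have "0 \<le> t * (b - a)" "0 \<le> (1 - t) * (b - a)" using t assms by auto
  then show "a \<le> Re z \<and> Re z \<le> b \<and> Im z = s * ((Re z - a) * (b - Re z))"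
    using t by (simp add: book_curve_def Let_def algebra_simps)
next
  assume z: "a \<le> Re z \<and> Re z \<le> b \<and> Im z = s * ((Re z - a) * (b - Re z))"
  define t where "t = (Re z - a) / (b - a)"
  have "a + t * (b - a) = Re z" using assms by (simp add: t_def)
  then have "z = book_curve s a b t" using z by (simp add: book_curve_def Let_def complex_eq_iff)
  moreover have "0 \<le> t" "t \<le> 1" using z assms by (auto simp: t_def divide_le_eq)
  ultimately show "z \<in> path_image (book_curve s a b)" by (auto simp: path_image_def)
qed

lemma arc_book_curve:
  assumes "a < b"
  shows "arc (book_curve s a b)"
proof -
  have "continuous_on {0..1} (book_curve s a b)"
    unfolding book_curve_def Let_def Complex_eq by (intro continuous_intros)
  moreover have "inj_on (book_curve s a b) {0..1}"
    using assms by (auto intro!: inj_onI simp: book_curve_def Let_def)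
  ultimately show ?thesis by (simp add: arc_def path_def)
qed

lemma book_curve_ends [simp]:
  "pathstart (book_curve s a b) = Complex a 0" "pathfinish (book_curve s a b) = Complex b 0"
  by (simp_all add: pathstart_def pathfinish_def book_curve_def)

text \<open>
On the same side, the intervals are nested or have at most an end in common; for nested intervals the
product \<open>(x - a) (b - x)\<close> is strictly larger for the outer interval wherever the inner one is positive.
On different sides, the curves are separated by the axis.
\<close>

lemma book_curves_meet:
  assumes "a < b" "c < d" "(a, b) \<noteq> (c, d)" "s \<in> {1, -1}" "s' \<in> {1, -1}"
    and noncrossing: "s = s' \<Longrightarrow> \<not> (a < c \<and> c < b \<and> b < d) \<and> \<not> (c < a \<and> a < d \<and> d < b)"
    and z: "z \<in> path_image (book_curve s a b)" "z \<in> path_image (book_curve s' c d)"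
  shows "Im z = 0 \<and> Re z \<in> {a, b} \<inter> {c, d}"
proof -
  define x where "x = Re z"
  have x: "a \<le> x" "x \<le> b" "c \<le> x" "x \<le> d" "Im z = s * ((x - a) * (b - x))" "Im z = s' * ((x - c) * (d - x))"
    using z assms(1,2) by (simp_all add: path_image_book_curve x_def)
  have pos: "0 \<le> (x - a) * (b - x)" "0 \<le> (x - c) * (d - x)" using x by simp_all
  have nested: "x \<in> {a, b} \<inter> {c, d}"
    if le: "a \<le> c" "d \<le> b" "(a, b) \<noteq> (c, d)" "c \<le> x" "x \<le> d" "(x - a) * (b - x) = (x - c) * (d - x)"
    for a b c d :: real
  proof -
    have "x = c \<or> x = d"
    proof (rule ccontr)
      assume "\<not> ?thesis"
      then have gt: "0 < x - c" "0 < d - x" using le by auto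
      have "(x - c) * (d - x) < (x - a) * (b - x)"
      proof (cases "a < c")
        case True
        then show ?thesis using gt le by (intro mult_less_le_imp_less) auto
      next
        case False
        then show ?thesis using gt le by (intro mult_le_less_imp_less) auto
      qed
      then show False using le by simp
    qed
    then show ?thesis using le by auto
  qed
  show ?thesis
  proof (cases "s = s'")
    case True
    then have eq: "(x - a) * (b - x) = (x - c) * (d - x)" using x(5,6) assms(4) by auto
    consider "a \<le> c" "d \<le> b" | "c \<le> a" "b \<le> d" | "b \<le> c" | "d \<le> a"
      using noncrossing[OF True] assms(1,2) by linarith
    then have "x \<in> {a, b} \<inter> {c, d}"
    proof cases
      case 1
      then show ?thesis using nested[of a c d b] eq x assms(3) by auto
    next
      case 2
      then show ?thesis using nested[of c a b d] eq x assms(3) by auto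
    qed (use x in auto)
    then show ?thesis using x by (auto simp: x_def)
  next
    case False
    then have "s' = - s" using assms(4,5) by auto
    then have "(x - a) * (b - x) = - ((x - c) * (d - x))" using x(5,6) assms(4) by auto
    then have "(x - a) * (b - x) = 0" "(x - c) * (d - x) = 0" using pos by linarith+
    then show ?thesis using x by (auto simp: x_def)
  qed
qed

lemma planar_book:
  fixes f :: "'a \<Rightarrow> real" and side :: "'a set \<Rightarrow> bool"
  assumes inj: "inj_on f (pverts H)"
    and wf: "\<And>u v. (u, v) \<in> parcs H \<Longrightarrow> u \<in> pverts H \<and> v \<in> pverts H \<and> u \<noteq> v"
    and sym: "\<And>u v. (u, v) \<in> parcs H \<Longrightarrow> (v, u) \<in> parcs H"
    and crossing: "\<And>u v x y. (u, v) \<in> parcs H \<Longrightarrow> (x, y) \<in> parcs H \<Longrightarrow>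
      f u < f x \<Longrightarrow> f x < f v \<Longrightarrow> f v < f y \<Longrightarrow> side {u, v} \<noteq> side {x, y}"
  shows "planar H"
proof -
  define pos where "pos u = Complex (f u) 0" for u
  define sg :: "'a set \<Rightarrow> real" where "sg e = (if side e then 1 else -1)" for e
  define \<gamma> where "\<gamma> e = book_curve (sg e) (Min (f ` e)) (Max (f ` e))" for e
  \<comment> \<open>The curve of an edge is indexed by the set of its ends, so it is drawn from the left end to the right end.\<close>
  have edge: "\<exists>a b. (a, b) \<in> parcs H \<and> {u, v} = {a, b} \<and> f a < f b \<and> \<gamma> {u, v} = book_curve (sg {u, v}) (f a) (f b)"
    if uv: "(u, v) \<in> parcs H" for u v
  proof -
    have "f u \<noteq> f v" using wf[OF uv] inj by (meson inj_onD)
    then consider "f u < f v" | "f v < f u" by linarith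
    then show ?thesis
    proof cases
      case 1
      then have "Min (f ` {u, v}) = f u" "Max (f ` {u, v}) = f v" by simp_all
      then show ?thesis using 1 uv by (intro exI[of _ u] exI[of _ v]) (simp add: \<gamma>_def)
    next
      case 2
      then have "Min (f ` {u, v}) = f v" "Max (f ` {u, v}) = f u" by simp_all
      then show ?thesis using 2 sym[OF uv] by (intro exI[of _ v] exI[of _ u]) (auto simp: \<gamma>_def)
    qed
  qed
  have sg: "sg e \<in> {1, -1}" for e by (simp add: sg_def)
  have "plane_drawing H pos \<gamma>"
    unfolding plane_drawing_def
  proof (intro conjI ballI)
    show "inj_on pos (pverts H)" using inj by (auto simp: pos_def inj_on_def)
  next
    fix e assume "e \<in> parcs H"
    then obtain u v where e: "e = (u, v)" "(u, v) \<in> parcs H" by (cases e) auto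
    obtain a b where ab: "(a, b) \<in> parcs H" "{u, v} = {a, b}" "f a < f b" "\<gamma> {u, v} = book_curve (sg {u, v}) (f a) (f b)"
      using edge[OF e(2)] by blast
    have "{pos u, pos v} = {pos a, pos b}" using ab(2) by (metis image_empty image_insert)
    moreover have "path_image (book_curve (sg {u, v}) (f a) (f b)) \<inter> pos ` pverts H = {pos a, pos b}"
    proof -
      have "w = a \<or> w = b" if "w \<in> pverts H" "pos w \<in> path_image (book_curve (sg {u, v}) (f a) (f b))" for w
      proof -
        have "f w = f a \<or> f w = f b"
          using that sg[of "{u, v}"] by (auto simp: pos_def path_image_book_curve[OF ab(3)])
        then show ?thesis using inj that wf[OF ab(1)] by (meson inj_onD)
      qed
      moreover have "pos a \<in> path_image (book_curve (sg {u, v}) (f a) (f b))" "pos b \<in> path_image (book_curve (sg {u, v}) (f a) (f b))"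
        using ab(3) by (simp_all add: path_image_book_curve pos_def)
      ultimately show ?thesis using wf[OF ab(1)] by blast
    qed
    ultimately show "case e of (u, v) \<Rightarrow> arc (\<gamma> {u, v}) \<and>
        {pathstart (\<gamma> {u, v}), pathfinish (\<gamma> {u, v})} = {pos u, pos v} \<and>
        path_image (\<gamma> {u, v}) \<inter> pos ` pverts H = {pos u, pos v}"
      unfolding e(1) using ab by (simp add: arc_book_curve pos_def)
  next
    fix e assume "e \<in> parcs H"
    then obtain u v where e: "e = (u, v)" "(u, v) \<in> parcs H" by (cases e) auto
    obtain a b where ab: "(a, b) \<in> parcs H" "{u, v} = {a, b}" "f a < f b" "\<gamma> {u, v} = book_curve (sg {u, v}) (f a) (f b)"
      using edge[OF e(2)] by blast
    have "path_image (\<gamma> {u, v}) \<inter> path_image (\<gamma> {x, y}) \<subseteq> pos ` ({u, v} \<inter> {x, y})"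
      if xy: "(x, y) \<in> parcs H" and ne: "{u, v} \<noteq> {x, y}" for x y
    proof
      fix z assume z: "z \<in> path_image (\<gamma> {u, v}) \<inter> path_image (\<gamma> {x, y})"
      obtain c d where cd: "(c, d) \<in> parcs H" "{x, y} = {c, d}" "f c < f d" "\<gamma> {x, y} = book_curve (sg {x, y}) (f c) (f d)"
        using edge[OF xy] by blast
      have V: "a \<in> pverts H" "b \<in> pverts H" "c \<in> pverts H" "d \<in> pverts H" using wf ab cd by blast+
      have "(f a, f b) \<noteq> (f c, f d)"
      proof
        assume "(f a, f b) = (f c, f d)"
        then have "a = c" "b = d" using inj V by (auto dest: inj_onD)
        then show False using ne ab(2) cd(2) by simp
      qed
      moreover have "\<not> (f a < f c \<and> f c < f b \<and> f b < f d) \<and> \<not> (f c < f a \<and> f a < f d \<and> f d < f b)"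
        if "sg {u, v} = sg {x, y}"
      proof -
        have "side {a, b} = side {c, d}" using that ab(2) cd(2) by (auto simp: sg_def split: if_splits)
        then show ?thesis using crossing[OF ab(1) cd(1)] crossing[OF cd(1) ab(1)] by auto
      qed
      ultimately have z: "Im z = 0 \<and> Re z \<in> {f a, f b} \<inter> {f c, f d}"
        using book_curves_meet[OF ab(3) cd(3) _ sg sg, of "{u, v}" "{x, y}" z] z ab(4) cd(4) by auto
      have "\<exists>w \<in> {a, b}. \<exists>w' \<in> {c, d}. z = pos w \<and> f w = f w'"
        using z by (auto simp: pos_def complex_eq_iff)
      then obtain w w' where "w \<in> {a, b}" "w' \<in> {c, d}" "z = pos w" "f w = f w'" by blast
      then have "w = w'" using V inj by (auto dest: inj_onD)
      then have "\<exists>w \<in> {a, b} \<inter> {c, d}. z = pos w" using \<open>w \<in> _\<close> \<open>w' \<in> _\<close> \<open>z = pos w\<close> by blast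
      then show "z \<in> pos ` ({u, v} \<inter> {x, y})" unfolding ab(2) cd(2) by blast
    qed
    then show "case e of (u, v) \<Rightarrow> \<forall>(x, y) \<in> parcs H. {u, v} \<noteq> {x, y} \<longrightarrow>
        path_image (\<gamma> {u, v}) \<inter> path_image (\<gamma> {x, y}) \<subseteq> pos ` ({u, v} \<inter> {x, y})"
      unfolding e(1) by auto
  qed
  then show ?thesis unfolding planar_def by blast
qed

section \<open>Crossing chords of a Jordan curve\<close>

text \<open>
The chord \<open>c\<close> splits the inside of the Jordan curve formed by \<open>c1\<close> and \<open>c2\<close> into the two regions bounded by
\<open>c1\<close>, \<open>c\<close> and by \<open>c2\<close>, \<open>c\<close>. The interior of \<open>d\<close> is connected and avoids \<open>c\<close>, so it stays in one of
these regions. The closure of a region contains no points of the opposite boundary arc other than \<open>a\<close>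
and \<open>b\<close>, but \<open>d\<close> has an end on either arc.
\<close>

lemma crossing_inside:
  fixes c c1 c2 d :: "real \<Rightarrow> complex"
  assumes c1: "arc c1" "pathstart c1 = a" "pathfinish c1 = b"
    and c2: "arc c2" "pathstart c2 = a" "pathfinish c2 = b"
    and c: "arc c" "pathstart c = a" "pathfinish c = b"
    and disj: "path_image c1 \<inter> path_image c2 = {a, b}"
      "path_image c1 \<inter> path_image c = {a, b}" "path_image c2 \<inter> path_image c = {a, b}"
    and c_in: "path_image c \<inter> inside (path_image c1 \<union> path_image c2) \<noteq> {}"
    and d: "arc d" "pathstart d = p" "pathfinish d = q"
    and p: "p \<in> path_image c1" "p \<notin> {a, b}" and q: "q \<in> path_image c2" "q \<notin> {a, b}"
    and d_disj: "path_image d \<inter> (path_image c1 \<union> path_image c2) = {p, q}" "path_image d \<inter> path_image c = {}"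
    and d_in: "path_image d \<inter> inside (path_image c1 \<union> path_image c2) \<noteq> {}"
  shows False
proof -
  let ?C1 = "path_image c1" and ?C2 = "path_image c2" and ?C = "path_image c"
  define D where "D = path_image d - {p, q}"
  have "a \<noteq> b" using c1 arc_distinct_ends by blast
  have closed: "closed ?C1" "closed ?C2" "closed ?C"
    using c1 c2 c by (auto intro: closed_arc_image)
  obtain I12: "inside (?C1 \<union> ?C) \<inter> inside (?C2 \<union> ?C) = {}"
    and I: "inside (?C1 \<union> ?C) \<union> inside (?C2 \<union> ?C) \<union> (?C - {a, b}) = inside (?C1 \<union> ?C2)"
    using split_inside_simple_closed_curve[of c1 a b c2 c] c1 c2 c \<open>a \<noteq> b\<close> disj c_in arc_imp_simple_path
    by metis
  have no: "inside (?C1 \<union> ?C2) \<inter> (?C1 \<union> ?C2) = {}" by (simp add: inside_no_overlap)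
  have D_conn: "connected D"
    using connected_simple_path_endless[of d] d arc_imp_simple_path unfolding D_def by blast
  have D_inside: "D \<subseteq> inside (?C1 \<union> ?C2)"
  proof -
    obtain w where w: "w \<in> path_image d" "w \<in> inside (?C1 \<union> ?C2)" using d_in by blast
    then have "w \<in> D" using p q no unfolding D_def by blast
    moreover have "D \<subseteq> - (?C1 \<union> ?C2)" using d_disj unfolding D_def by blast
    ultimately have "connected_component (- (?C1 \<union> ?C2)) w z" if "z \<in> D" for z
      using D_conn that unfolding connected_component_def by blast
    then show ?thesis using w(2) inside_same_component by blast
  qed
  then have "D \<subseteq> inside (?C1 \<union> ?C) \<union> inside (?C2 \<union> ?C)"
    using I d_disj(2) unfolding D_def by blast
  moreover have "open (inside (?C1 \<union> ?C))" "open (inside (?C2 \<union> ?C))"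
    using closed by (auto intro: open_inside)
  ultimately have "D \<subseteq> inside (?C1 \<union> ?C) \<or> D \<subseteq> inside (?C2 \<union> ?C)"
    using D_conn I12 unfolding connected_def by blast
  moreover have ends: "{p, q} \<subseteq> closure D"
  proof -
    have "D = d ` {0<..<1}" using simple_path_endless[of d] d arc_imp_simple_path unfolding D_def by metis
    moreover have "continuous_on (closure {0<..<1}) d"
      using arc_imp_path[OF d(1)] by (simp add: path_def)
    then have "d ` closure {0<..<1} \<subseteq> closure (d ` {0<..<1})"
      by (rule image_closure_subset) (auto simp: closure_subset)
    ultimately show ?thesis using d by (auto simp: pathstart_def pathfinish_def)
  qed
  moreover have "x \<in> B \<union> ?C" if "D \<subseteq> inside (B \<union> ?C)" "x \<in> {p, q}"
    "closed B" "inside (B \<union> ?C) \<subseteq> inside (?C1 \<union> ?C2)" for x B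
  proof -
    have "closure (inside (B \<union> ?C)) \<subseteq> (B \<union> ?C) \<union> inside (B \<union> ?C)"
      using that closed by (intro closure_inside_subset) auto
    moreover have "x \<in> closure (inside (B \<union> ?C))" using ends that closure_mono by blast
    moreover have "x \<notin> inside (?C1 \<union> ?C2)" using that(2) p q no by blast
    ultimately show ?thesis using that(4) by blast
  qed
  ultimately have "q \<in> ?C1 \<union> ?C \<or> p \<in> ?C2 \<union> ?C"
    using I closed by blast
  then show False using p q disj by blast
qed

text \<open>
If the image of \<open>w\<close> were not inside, its component in the complement would be unbounded. Without the
point \<open>0\<close> the component is still connected, and inverting it back gives a connected set that
avoids \<open>K\<close> and joins \<open>w\<close> to points close to \<open>z0\<close>.
\<close>

lemma inversion_outside:
  fixes K :: "complex set"
  assumes K: "compact K" and z0: "z0 \<in> inside K" and w: "w \<in> outside K"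
  shows "inverse (w - z0) \<in> inside ((\<lambda>z. inverse (z - z0)) ` K)"
proof -
  let ?f = "\<lambda>z. inverse (z - z0)" and ?g = "\<lambda>u. z0 + inverse u"
  have gf: "?g (?f z) = z" for z by simp
  have fg: "?f (?g u) = u" for u by simp
  have z0K: "z0 \<notin> K" using z0 inside_no_overlap by blast
  have wK: "w \<notin> K" using w outside_no_overlap by blast
  have wz0: "w \<noteq> z0" using z0 w inside_Int_outside by blast
  have notin: "?f w \<notin> ?f ` K" using wK by auto
  have "compact (?f ` K)"
    using K z0K by (intro compact_continuous_image continuous_intros) auto
  then have closed: "closed (?f ` K)" by (rule compact_imp_closed)
  define U where "U = connected_component_set (- ?f ` K) (?f w)"
  have "bounded U"
  proof (rule ccontr)
    assume unb: "\<not> bounded U"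
    have "open U" using closed unfolding U_def by (intro open_connected_component) auto
    have conn: "connected (U - {0})"
      using \<open>open U\<close> by (intro connected_open_delete) (auto simp: U_def)
    define V where "V = ?g ` (U - {0})"
    have "connected V" unfolding V_def
      using conn by (intro connected_continuous_image continuous_intros) auto
    moreover have "w \<in> V"
    proof -
      have "?f w \<in> U" using notin by (simp add: U_def)
      then show ?thesis using wz0 gf[of w] unfolding V_def by (intro image_eqI[of _ _ "?f w"]) auto
    qed
    moreover have "V \<subseteq> - K"
    proof -
      have "U \<subseteq> - ?f ` K" unfolding U_def by (rule connected_component_subset)
      then show ?thesis using fg unfolding V_def by (force simp: image_iff)
    qed
    moreover have "\<exists>v \<in> V. v \<in> inside K"
    proof -
      have "open (inside K)" using K compact_imp_closed open_inside by blast
      then obtain e where e: "0 < e" "ball z0 e \<subseteq> inside K" using z0 open_contains_ball by blast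
      obtain u where u: "u \<in> U" "inverse e < norm u"
        using unb unfolding bounded_iff by (meson not_le)
      then have "u \<noteq> 0" using e by auto
      have "norm (inverse u) < e"
        using less_imp_inverse_less[OF u(2)] e(1) by (simp add: norm_inverse)
      then have "?g u \<in> inside K" using e(2) by (auto simp: dist_norm subset_iff)
      then show ?thesis using u \<open>u \<noteq> 0\<close> unfolding V_def by blast
    qed
    ultimately obtain v where "connected_component (- K) v w" "v \<in> inside K"
      unfolding connected_component_def by blast
    then have "w \<in> inside K" using inside_same_component by blast
    then show False using w inside_Int_outside by blast
  qed
  then show ?thesis using notin unfolding inside_def U_def by blast
qed

text \<open>
Two chords inside the curve are handled directly, and two chords outside after an inversion about
a point inside the curve.
\<close>

lemma crossing_same_side:
  fixes c c1 c2 d :: "real \<Rightarrow> complex"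
  assumes c1: "arc c1" "pathstart c1 = a" "pathfinish c1 = b"
    and c2: "arc c2" "pathstart c2 = a" "pathfinish c2 = b"
    and c: "arc c" "pathstart c = a" "pathfinish c = b"
    and disj: "path_image c1 \<inter> path_image c2 = {a, b}"
      "path_image c1 \<inter> path_image c = {a, b}" "path_image c2 \<inter> path_image c = {a, b}"
    and d: "arc d" "pathstart d = p" "pathfinish d = q"
    and p: "p \<in> path_image c1" "p \<notin> {a, b}" and q: "q \<in> path_image c2" "q \<notin> {a, b}"
    and d_disj: "path_image d \<inter> (path_image c1 \<union> path_image c2) = {p, q}" "path_image d \<inter> path_image c = {}"
  shows "(path_image c \<inter> inside (path_image c1 \<union> path_image c2) = {}) \<noteq>
    (path_image d \<inter> inside (path_image c1 \<union> path_image c2) = {})"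
proof
  let ?K = "path_image c1 \<union> path_image c2"
  assume eq: "(path_image c \<inter> inside ?K = {}) = (path_image d \<inter> inside ?K = {})"
  show False
  proof (cases "path_image c \<inter> inside ?K = {}")
    case False
    then show False using crossing_inside[OF c1 c2 c disj _ d p q d_disj] eq by blast
  next
    case True
    have "a \<noteq> b" using c1 arc_distinct_ends by blast
    have "simple_path (c1 +++ reversepath c2)"
      using c1 c2 disj by (intro simple_path_join_loop) (auto simp: arc_reversepath)
    moreover have "path_image (c1 +++ reversepath c2) = ?K"
      using c1 c2 by (simp add: path_image_join)
    ultimately have "inside ?K \<noteq> {}"
      using Jordan_inside_outside[of "c1 +++ reversepath c2"] c1 c2 by simp
    then obtain z0 where z0: "z0 \<in> inside ?K" by blast
    define f where "f z = inverse (z - z0)" for z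
    have inj: "inj f" by (auto simp: f_def inj_on_def)
    have K: "compact ?K" using c1 c2 by (auto intro!: compact_Un compact_arc_image)
    have no: "z0 \<notin> ?K" using z0 inside_no_overlap by blast
    have avoid: "z0 \<notin> path_image c" "z0 \<notin> path_image d" using z0 True eq by blast+
    have arc_f: "arc (f \<circ> g)" if "arc g" "z0 \<notin> path_image g" for g
    proof -
      have "continuous_on (path_image g) f" unfolding f_def
        using that(2) by (intro continuous_intros) auto
      then show ?thesis using that inj
        by (auto simp: arc_def path_continuous_image intro: comp_inj_on inj_on_subset)
    qed
    have ends: "pathstart (f \<circ> g) = f (pathstart g)" "pathfinish (f \<circ> g) = f (pathfinish g)" for g
      by (simp_all add: pathstart_def pathfinish_def)
    have img: "path_image (f \<circ> g) = f ` path_image g" for g by (simp add: path_image_def image_comp)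
    have ne_mid: "\<exists>w \<in> path_image g. w \<notin> {pathstart g, pathfinish g}" if "arc g" for g :: "real \<Rightarrow> complex"
      using nonempty_simple_path_endless[of g] that arc_imp_simple_path by blast
    have meet: "path_image (f \<circ> g) \<inter> inside (f ` ?K) \<noteq> {}"
      if "arc g" "path_image g \<inter> inside ?K = {}" "path_image g \<inter> ?K \<subseteq> {pathstart g, pathfinish g}" for g
    proof -
      obtain w where "w \<in> path_image g" "w \<notin> {pathstart g, pathfinish g}" using ne_mid \<open>arc g\<close> by blast
      then have "w \<in> outside ?K" using that by (auto simp: outside_inside)
      then have "f w \<in> inside (f ` ?K)" using inversion_outside[OF K z0] unfolding f_def by blast
      then show ?thesis unfolding img using \<open>w \<in> path_image g\<close> by blast
    qed
    have int: "f ` A \<inter> f ` B = f ` (A \<inter> B)" for A B using inj by (simp add: image_Int)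
    have m1: "path_image (f \<circ> c) \<inter> inside (path_image (f \<circ> c1) \<union> path_image (f \<circ> c2)) \<noteq> {}"
      using meet[of c] c True disj by (auto simp: img image_Un)
    have m2: "path_image (f \<circ> d) \<inter> inside (path_image (f \<circ> c1) \<union> path_image (f \<circ> c2)) \<noteq> {}"
      using meet[of d] d True eq d_disj by (auto simp: img image_Un)
    show False
    proof (rule crossing_inside[of "f \<circ> c1" "f a" "f b" "f \<circ> c2" "f \<circ> c" "f \<circ> d" "f p" "f q", OF _ _ _ _ _ _ _ _ _ _ _ _ m1 _ _ _ _ _ _ _ _ _ m2])
    qed (use c1 c2 c d no avoid p q disj d_disj inj in
      \<open>simp_all add: arc_f ends img int image_Un[symmetric] inj_image_mem_iff inj_eq\<close>)
  qed
qed

section \<open>The Hamiltonian cycle of a plane graph\<close>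

lemma pcas_verts:
  assumes "pcas u p w"
  shows "pawalk_verts u p = u # map snd p"
    and "Suc i < length p \<Longrightarrow> fst (p ! Suc i) = snd (p ! i)"
    and "p \<noteq> [] \<Longrightarrow> fst (p ! 0) = u" and "p \<noteq> [] \<Longrightarrow> snd (last p) = w"
  using assms
proof (induction p arbitrary: u i)
  case (Cons e p)
  { case 1 then show ?case using Cons.IH(1) by simp }
  { case 2 then show ?case using Cons.IH(2,3) by (cases i) auto }
  { case 3 then show ?case by simp }
  { case 4 then show ?case using Cons.IH(4) by auto }
qed auto

text \<open>
The cycle is listed by the heads of its arcs, since these are what the definition of a cycle requires to
be distinct; its periodic continuation to the integers is injective modulo the number of vertices.
\<close>

lemma hamiltonian_cycle:
  assumes "hamiltonian G"
  obtains v :: "int \<Rightarrow> 'a"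
  where "\<And>x y. v x = v y \<longleftrightarrow> int (card (pverts G)) dvd x - y"
    and "range v = pverts G" and "\<And>x. (v x, v (x + 1)) \<in> parcs G"
proof -
  obtain p u where p: "set p \<subseteq> parcs G" "pcas u p u" "distinct (tl (pawalk_verts u p))"
    "3 \<le> length p" "fst ` set p = pverts G"
    using assms
    unfolding hamiltonian_def pre_digraph.cycle_def pre_digraph.awalk_def
      cas_with_proj_eq awalk_verts_with_proj_eq with_proj_simps by blast
  have ne: "p \<noteq> []" using p(4) by auto
  have dist: "distinct (map snd p)" using p(3) pcas_verts(1)[OF p(2)] by simp
  define m where "m = length p"
  have m: "0 < m" using ne by (simp add: m_def)
  have wrap: "fst (p ! (Suc i mod m)) = snd (p ! i)" if "i < m" for i
  proof (cases "Suc i < m")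
    case True
    then show ?thesis using pcas_verts(2)[OF p(2)] by (simp add: m_def)
  next
    case False
    then have i: "Suc i = m" using that by simp
    have "i = length p - 1" using i by (simp add: m_def)
    then have "snd (p ! i) = snd (last p)" using ne by (simp add: last_conv_nth)
    then show ?thesis using i pcas_verts(3,4)[OF p(2) ne] by simp
  qed
  have verts: "snd ` set p = pverts G"
  proof -
    have "fst ` set p = (\<lambda>i. fst (p ! i)) ` {..<m}" by (auto simp: set_conv_nth m_def)
    also have "{..<m} = (\<lambda>i. Suc i mod m) ` {..<m}"
    proof (intro equalityI subsetI)
      fix j assume j: "j \<in> {..<m}"
      show "j \<in> (\<lambda>i. Suc i mod m) ` {..<m}"
      proof (cases j)
        case 0
        then show ?thesis using m by (intro image_eqI[of _ _ "m - 1"]) auto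
      next
        case (Suc i)
        then show ?thesis using j by (intro image_eqI[of _ _ i]) auto
      qed
    qed (use m in auto)
    also have "(\<lambda>i. fst (p ! i)) ` (\<lambda>i. Suc i mod m) ` {..<m} = (\<lambda>i. snd (p ! i)) ` {..<m}"
      unfolding image_image by (rule image_cong) (simp_all add: wrap)
    also have "\<dots> = snd ` set p" by (auto simp: set_conv_nth m_def)
    finally show ?thesis using p(5) by simp
  qed
  have card: "card (pverts G) = m"
    using verts dist distinct_card[OF dist] by (simp add: m_def)
  define v where "v x = snd (p ! nat (x mod int m))" for x
  have rng: "nat (x mod int m) < m" for x using m by (simp add: nat_less_iff)
  show ?thesis
  proof (rule that[of v])
    show "v x = v y \<longleftrightarrow> int (card (pverts G)) dvd x - y" for x y
    proof -
      have "v x = v y \<longleftrightarrow> nat (x mod int m) = nat (y mod int m)"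
        using nth_eq_iff_index_eq[OF dist, of "nat (x mod int m)" "nat (y mod int m)"] rng[of x] rng[of y]
        by (simp add: v_def m_def)
      also have "\<dots> \<longleftrightarrow> x mod int m = y mod int m" using m by (simp add: eq_nat_nat_iff)
      finally show ?thesis unfolding card by (simp add: mod_eq_dvd_iff)
    qed
    show "range v = pverts G"
    proof -
      have "snd (p ! i) \<in> range v" if "i < m" for i
        using that by (intro range_eqI[of _ _ "int i"]) (simp add: v_def)
      then have "snd ` set p \<subseteq> range v" by (auto simp: set_conv_nth m_def)
      moreover have "range v \<subseteq> snd ` set p" using rng by (auto simp: v_def m_def)
      ultimately show ?thesis using verts by blast
    qed
    show "(v x, v (x + 1)) \<in> parcs G" for x
    proof -
      let ?i = "nat (x mod int m)"
      have "int (Suc ?i mod m) = (x + 1) mod int m"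
        using m by (simp add: zmod_int mod_add_right_eq add.commute)
      then have "nat ((x + 1) mod int m) = Suc ?i mod m" by simp
      then have "p ! nat ((x + 1) mod int m) = (v x, v (x + 1))"
        using wrap[OF rng[of x]] by (simp add: v_def prod_eq_iff)
      moreover have "p ! nat ((x + 1) mod int m) \<in> set p" using rng[of "x + 1"] by (simp add: m_def)
      ultimately show ?thesis using p(1) by auto
    qed
  qed
qed

locale cyclic_plane_graph =
  fixes G :: "'a pair_pre_digraph" and n :: int and v :: "int \<Rightarrow> 'a"
    and pos :: "'a \<Rightarrow> complex" and \<gamma> :: "'a set \<Rightarrow> real \<Rightarrow> complex"
  assumes graph: "pair_graph G" and n_ge: "4 \<le> n"
    and v_eq: "v x = v y \<longleftrightarrow> n dvd x - y"
    and range_v: "range v = pverts G"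
    and cycle_edge: "(v x, v (x + 1)) \<in> parcs G"
    and drawing: "plane_drawing G pos \<gamma>"
begin

lemma arc_sym: "(u, w) \<in> parcs G \<Longrightarrow> (w, u) \<in> parcs G"
  using graph by (simp add: pair_graph_def pair_pseudo_graph_def pair_sym_digraph_def
      pair_sym_digraph_axioms_def symmetric_def sym_def)

lemma no_loop: "(u, u) \<notin> parcs G"
  using pair_loopfree_digraph.pair_no_loops graph
  by (fastforce simp: pair_graph_def pair_digraph_def)

lemma v_neq: "0 < j - i \<Longrightarrow> j - i < n \<Longrightarrow> v i \<noteq> v j"
  using zdvd_not_zless[of "j - i" n] dvd_minus_iff[of n "i - j"] by (auto simp: v_eq)

lemma pos_inj: "pos (v i) = pos (v j) \<longleftrightarrow> v i = v j"
  using drawing range_v unfolding plane_drawing_def by (metis inj_onD rangeI)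

text \<open>
The curve of an edge has no preferred orientation; it can be traversed from either end.
\<close>

lemma curve:
  assumes "(u, w) \<in> parcs G"
  obtains g where "arc g" "pathstart g = pos u" "pathfinish g = pos w" "path_image g = path_image (\<gamma> {u, w})"
proof -
  have *: "arc (\<gamma> {u, w})" "{pathstart (\<gamma> {u, w}), pathfinish (\<gamma> {u, w})} = {pos u, pos w}"
    using drawing assms unfolding plane_drawing_def by blast+
  show ?thesis
  proof (cases "pathstart (\<gamma> {u, w}) = pos u")
    case True
    then show ?thesis using * that[of "\<gamma> {u, w}"] by (auto simp: doubleton_eq_iff)
  next
    case False
    then show ?thesis using * that[of "reversepath (\<gamma> {u, w})"] by (auto simp: doubleton_eq_iff arc_reversepath)
  qed
qed

lemma curves_meet:
  assumes "(u, w) \<in> parcs G" "(x, y) \<in> parcs G" "{u, w} \<noteq> {x, y}"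
  shows "path_image (\<gamma> {u, w}) \<inter> path_image (\<gamma> {x, y}) \<subseteq> pos ` ({u, w} \<inter> {x, y})"
  using drawing assms unfolding plane_drawing_def by blast

lemma pos_in_curve:
  assumes "(u, w) \<in> parcs G"
  shows "pos u \<in> path_image (\<gamma> {u, w})" "pos w \<in> path_image (\<gamma> {u, w})"
  using curve[OF assms] by (metis pathstart_in_path_image pathfinish_in_path_image)+

definition side_curve :: "int \<Rightarrow> complex set" where
  "side_curve k = path_image (\<gamma> {v k, v (k + 1)})"

lemma cycle_curves_meet:
  assumes "0 < l - k" "l - k < n"
  shows "side_curve k \<inter> side_curve l \<subseteq> pos ` ({v k, v (k + 1)} \<inter> {v l, v (l + 1)})"
proof -
  have "v k \<noteq> v l" using v_neq assms by simp
  moreover have "\<not> (v k = v (l + 1) \<and> v (k + 1) = v l)"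
  proof
    assume "v k = v (l + 1) \<and> v (k + 1) = v l"
    then have "n dvd (k - (l + 1)) - ((k + 1) - l)" unfolding v_eq by (blast intro: dvd_diff)
    then have "n dvd 2" using dvd_minus_iff[of n 2] by simp
    then show False using zdvd_imp_le[of n 2] n_ge by simp
  qed
  ultimately show ?thesis
    unfolding side_curve_def by (intro curves_meet cycle_edge) (auto simp: doubleton_eq_iff)
qed

lemma chord_meets_cycle:
  assumes "(v x, v (x + d)) \<in> parcs G" "1 < d" "d < n - 1"
  shows "side_curve k \<inter> path_image (\<gamma> {v x, v (x + d)}) \<subseteq> {pos (v x), pos (v (x + d))}"
proof -
  have "{v k, v (k + 1)} \<noteq> {v x, v (x + d)}"
  proof
    assume "{v k, v (k + 1)} = {v x, v (x + d)}"
    then consider "v k = v x" "v (k + 1) = v (x + d)" | "v k = v (x + d)" "v (k + 1) = v x"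
      by (auto simp: doubleton_eq_iff)
    then show False
    proof cases
      case 1
      then have "n dvd (k - x) - ((k + 1) - (x + d))" unfolding v_eq by (blast intro: dvd_diff)
      then show False using zdvd_not_zless[of "d - 1" n] assms by simp
    next
      case 2
      then have "n dvd ((k + 1) - x) - (k - (x + d))" unfolding v_eq by (blast intro: dvd_diff)
      then show False using zdvd_not_zless[of "d + 1" n] assms by (simp add: add.commute)
    qed
  qed
  from curves_meet[OF cycle_edge assms(1) this]
  have "side_curve k \<inter> path_image (\<gamma> {v x, v (x + d)}) \<subseteq> pos ` ({v k, v (k + 1)} \<inter> {v x, v (x + d)})"
    unfolding side_curve_def .
  also have "\<dots> \<subseteq> pos ` {v x, v (x + d)}" by (rule image_mono) simp
  finally show ?thesis by simp
qed

text \<open>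
Fewer than \<open>n\<close> consecutive curves of the cycle join to an arc. The bound keeps the two ends distinct.
\<close>

lemma cycle_path:
  assumes "0 < m" "int m < n"
  shows "\<exists>g. arc g \<and> pathstart g = pos (v x) \<and> pathfinish g = pos (v (x + int m)) \<and>
    path_image g = (\<Union>k \<in> {x..<x + int m}. side_curve k)"
  using assms
proof (induction m)
  case (Suc m)
  obtain h where h: "arc h" "pathstart h = pos (v (x + int m))" "pathfinish h = pos (v (x + int m + 1))"
    "path_image h = side_curve (x + int m)"
    using curve[OF cycle_edge[of "x + int m"]] unfolding side_curve_def by blast
  show ?case
  proof (cases "m = 0")
    case True
    moreover have "{x..<x + 1} = {x}" by auto
    ultimately show ?thesis using h by (intro exI[of _ h]) simp
  next
    case False
    then obtain g where g: "arc g" "pathstart g = pos (v x)" "pathfinish g = pos (v (x + int m))"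
      "path_image g = (\<Union>k \<in> {x..<x + int m}. side_curve k)"
      using Suc by auto
    have "path_image g \<inter> path_image h \<subseteq> {pathstart h}"
    proof -
      have "side_curve k \<inter> side_curve (x + int m) \<subseteq> {pos (v (x + int m))}" if "x \<le> k" "k < x + int m" for k
      proof -
        have "v k \<noteq> v (x + int m)" "v k \<noteq> v (x + int m + 1)" "v (k + 1) \<noteq> v (x + int m + 1)"
          using that Suc.prems by (intro v_neq; simp)+
        then show ?thesis using cycle_curves_meet[of "x + int m" k] that Suc.prems by auto
      qed
      then show ?thesis unfolding g(4) h(2,4) by fastforce
    qed
    then have "arc (g +++ h)" using g h by (intro arc_join) auto
    moreover have "{x..<x + int (Suc m)} = insert (x + int m) {x..<x + int m}" by auto
    ultimately show ?thesis
      using g h by (intro exI[of _ "g +++ h"]) (auto simp: path_image_join algebra_simps)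
  qed
qed simp

definition jordan_curve :: "complex set" where
  "jordan_curve = (\<Union>k. side_curve k)"

text \<open>
The cycle may be cut open at any vertex \<open>x\<close>, in particular at an end of the chord under consideration.
\<close>

lemma jordan_curve_eq: "jordan_curve = (\<Union>k \<in> {x..<x + n}. side_curve k)"
proof -
  have "side_curve k = side_curve (x + (k - x) mod n)" for k
  proof -
    have "n dvd k - (x + (k - x) mod n)"
      by (metis diff_diff_eq dvd_minus_mod)
    then have "v k = v (x + (k - x) mod n)" "v (k + 1) = v (x + (k - x) mod n + 1)"
      unfolding v_eq by (simp_all add: algebra_simps)
    then show ?thesis by (simp add: side_curve_def)
  qed
  moreover have "x + (k - x) mod n \<in> {x..<x + n}" for k using n_ge by simp
  ultimately show ?thesis unfolding jordan_curve_def by blast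
qed

definition outer :: "'a set \<Rightarrow> bool" where
  "outer e \<longleftrightarrow> path_image (\<gamma> e) \<inter> inside jordan_curve = {}"

text \<open>
The ends of the first chord divide the cycle into two arcs, and the second chord joins an interior vertex of
one arc to an interior vertex of the other.
\<close>

lemma crossing_chords:
  assumes "0 < a" "a < d" "d < b" "b < n"
    and c: "(v x, v (x + d)) \<in> parcs G" and c': "(v (x + a), v (x + b)) \<in> parcs G"
  shows "outer {v x, v (x + d)} \<noteq> outer {v (x + a), v (x + b)}"
proof -
  let ?A = "pos (v x)" and ?B = "pos (v (x + d))" and ?p = "pos (v (x + a))" and ?q = "pos (v (x + b))"
  have d: "1 < d" "d < n - 1" and ba: "1 < b - a" "b - a < n - 1" using assms by auto
  have dist: "v x \<noteq> v (x + a)" "v x \<noteq> v (x + d)" "v x \<noteq> v (x + b)" "v (x + a) \<noteq> v (x + d)"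
    "v (x + a) \<noteq> v (x + b)" "v (x + d) \<noteq> v (x + b)"
    using assms by (intro v_neq; simp)+
  have vn: "v (x + n) = v x" by (simp add: v_eq)
  obtain c1 where c1: "arc c1" "pathstart c1 = ?A" "pathfinish c1 = ?B"
    "path_image c1 = (\<Union>k \<in> {x..<x + d}. side_curve k)"
    using cycle_path[of "nat d" x] assms by auto
  obtain c2' where c2': "arc c2'" "pathstart c2' = ?B" "pathfinish c2' = ?A"
    "path_image c2' = (\<Union>k \<in> {x + d..<x + n}. side_curve k)"
    using cycle_path[of "nat (n - d)" "x + d"] assms vn by auto
  define c2 where "c2 = reversepath c2'"
  have c2: "arc c2" "pathstart c2 = ?A" "pathfinish c2 = ?B"
    "path_image c2 = (\<Union>k \<in> {x + d..<x + n}. side_curve k)"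
    using c2' by (simp_all add: c2_def arc_reversepath)
  obtain g where g: "arc g" "pathstart g = ?A" "pathfinish g = ?B" "path_image g = path_image (\<gamma> {v x, v (x + d)})"
    using curve[OF c] by blast
  obtain h where h: "arc h" "pathstart h = ?p" "pathfinish h = ?q" "path_image h = path_image (\<gamma> {v (x + a), v (x + b)})"
    using curve[OF c'] by blast
  have J: "path_image c1 \<union> path_image c2 = jordan_curve"
  proof -
    have "{x..<x + n} = {x..<x + d} \<union> {x + d..<x + n}" using assms by auto
    then show ?thesis unfolding jordan_curve_eq[of x] c1(4) c2(4) by blast
  qed
  have ends: "{?A, ?B} \<subseteq> path_image c1" "{?A, ?B} \<subseteq> path_image c2" "{?A, ?B} \<subseteq> path_image g"
    "{?p, ?q} \<subseteq> path_image h"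
    using c1 c2 g h by (metis pathstart_in_path_image pathfinish_in_path_image empty_subsetI insert_subset)+
  have c12: "path_image c1 \<inter> path_image c2 \<subseteq> {?A, ?B}"
  proof -
    have "side_curve k \<inter> side_curve l \<subseteq> {?A, ?B}"
      if kl: "x \<le> k" "k < x + d" "x + d \<le> l" "l < x + n" for k l
    proof -
      have 1: "v k \<noteq> v l" using kl by (intro v_neq) auto
      have 2: "v (k + 1) = v l \<Longrightarrow> k + 1 = x + d"
        using v_neq[of l "k + 1"] kl by (cases "l = k + 1") auto
      have 3: "v (k + 1) \<noteq> v (l + 1)" using kl by (intro v_neq) auto
      have 4: "v k = v (l + 1) \<Longrightarrow> k = x"
        using v_neq[of "l + 1" k] kl by (cases "l + 1 = k + n") auto
      show ?thesis using cycle_curves_meet[of l k] kl 1 2 3 4 by auto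
    qed
    then show ?thesis unfolding c1(4) c2(4) by fastforce
  qed
  have c_g: "path_image c1 \<inter> path_image g \<subseteq> {?A, ?B}" "path_image c2 \<inter> path_image g \<subseteq> {?A, ?B}"
    unfolding c1(4) c2(4) g(4) using chord_meets_cycle[OF c d] by blast+
  have c_h: "path_image h \<inter> (path_image c1 \<union> path_image c2) \<subseteq> {?p, ?q}"
    unfolding c1(4) c2(4) h(4) using chord_meets_cycle[of "x + a" "b - a"] c' ba by fastforce
  have p: "?p \<in> path_image c1"
    unfolding c1(4) side_curve_def using pos_in_curve(1)[OF cycle_edge[of "x + a"]] assms by auto
  have q: "?q \<in> path_image c2"
    unfolding c2(4) side_curve_def using pos_in_curve(1)[OF cycle_edge[of "x + b"]] assms by auto
  have gh: "path_image h \<inter> path_image g = {}"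
    unfolding g(4) h(4) using curves_meet[OF c' c] dist by (auto simp: doubleton_eq_iff)
  have "(path_image g \<inter> inside jordan_curve = {}) \<noteq> (path_image h \<inter> inside jordan_curve = {})"
    unfolding J[symmetric]
  proof (rule crossing_same_side[OF c1(1-3) c2(1-3) g(1-3) _ _ _ h(1-3) p _ q _ _ gh])
    show "?p \<notin> {?A, ?B}" "?q \<notin> {?A, ?B}" using dist by (auto simp: pos_inj)
  qed (use ends c12 c_g c_h p q in blast)+
  then show ?thesis by (simp add: outer_def g(4) h(4))
qed

text \<open>
If the page \<open>s\<close> held no chord interleaving with the missing edge, the graph with this edge could be drawn as
a book with the vertices in the order of the cycle, starting at \<open>x\<close>, and the new edge on the page \<open>s\<close>.
\<close>

lemma blocked_chord:
  assumes max: "maximal_planar G" and d: "0 < d" "d < n" and nonedge: "(v x, v (x + d)) \<notin> parcs G"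
  shows "\<exists>a b. 0 < a \<and> a < d \<and> d < b \<and> b < n \<and> (v (x + a), v (x + b)) \<in> parcs G \<and>
    outer {v (x + a), v (x + b)} = s"
proof (rule ccontr)
  assume none: "\<not> ?thesis"
  let ?u = "v x" and ?w = "v (x + d)"
  let ?H = "add_edge G ?u ?w"
  have uw: "?u \<noteq> ?w" using v_neq d by simp
  define f where "f z = inv_into {0..<n} (\<lambda>k. v (x + k)) z" for z
  have inj: "inj_on (\<lambda>k. v (x + k)) {0..<n}"
  proof (rule inj_onI)
    fix k l assume "k \<in> {0..<n}" "l \<in> {0..<n}" "v (x + k) = v (x + l)"
    then show "k = l" using v_neq[of "x + k" "x + l"] v_neq[of "x + l" "x + k"] by (cases k l rule: linorder_cases) auto
  qed
  have image: "(\<lambda>k. v (x + k)) ` {0..<n} = pverts G"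
  proof -
    have "v k \<in> (\<lambda>k. v (x + k)) ` {0..<n}" for k
    proof (rule image_eqI)
      have "n dvd k - (x + (k - x) mod n)" by (metis diff_diff_eq dvd_minus_mod)
      then show "v k = v (x + (k - x) mod n)" by (simp add: v_eq)
    qed (use n_ge in simp)
    then show ?thesis unfolding range_v[symmetric] by blast
  qed
  have f_v: "f (v (x + k)) = k" if "0 \<le> k" "k < n" for k
    unfolding f_def using inv_into_f_f[OF inj] that by auto
  have f_u: "f ?u = 0" using f_v[of 0] n_ge by simp
  have v_f: "v (x + f z) = z" and f_rng: "0 \<le> f z" "f z < n" if "z \<in> pverts G" for z
    using f_inv_into_f[of z "\<lambda>k. v (x + k)" "{0..<n}"] inv_into_into[of z "\<lambda>k. v (x + k)" "{0..<n}"] that image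
    by (auto simp: f_def)
  have verts: "y \<in> pverts G \<and> z \<in> pverts G" if "(y, z) \<in> parcs G" for y z
    using graph that unfolding pair_graph_def pair_digraph_def pair_fin_digraph_def
    by (metis fst_conv snd_conv pair_wf_digraph.arc_fst_in_verts pair_wf_digraph.arc_snd_in_verts)
  have arcs_H: "(y, z) \<in> parcs ?H \<longleftrightarrow> (y, z) \<in> parcs G \<or> (y, z) = (?u, ?w) \<or> (y, z) = (?w, ?u)" for y z
    by (auto simp: add_edge_def)
  have "planar ?H"
  proof (rule planar_book[where f = "\<lambda>z. real_of_int (f z)" and side = "\<lambda>e. if e = {?u, ?w} then s else outer e"])
    show "inj_on (\<lambda>z. real_of_int (f z)) (pverts ?H)"
      using v_f by (auto simp: add_edge_def inj_on_def) metis
    show "y \<in> pverts ?H \<and> z \<in> pverts ?H \<and> y \<noteq> z" if "(y, z) \<in> parcs ?H" for y z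
      using that verts[of y z] uw range_v no_loop by (auto simp: arcs_H) (auto simp: add_edge_def)
    show "(z, y) \<in> parcs ?H" if "(y, z) \<in> parcs ?H" for y z
      using that arc_sym by (auto simp: arcs_H)
    fix y z y' z'
    assume yz: "(y, z) \<in> parcs ?H" and yz': "(y', z') \<in> parcs ?H"
      and "real_of_int (f y) < real_of_int (f y')" "real_of_int (f y') < real_of_int (f z)"
        "real_of_int (f z) < real_of_int (f z')"
    then have lt: "f y < f y'" "f y' < f z" "f z < f z'" by auto
    have V: "y \<in> pverts G" "z \<in> pverts G" "y' \<in> pverts G" "z' \<in> pverts G"
      using yz yz' verts range_v by (auto simp: arcs_H)
    \<comment> \<open>The position \<open>x\<close> is the leftmost one, so the new edge can only be the first of two interleaving edges.\<close>
    have old': "(y', z') \<in> parcs G" "{y', z'} \<noteq> {?u, ?w}"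
    proof -
      have "y' \<noteq> ?u" "z' \<noteq> ?u" using lt f_u f_rng[OF V(1)] by auto
      then show "(y', z') \<in> parcs G" "{y', z'} \<noteq> {?u, ?w}"
        using yz' by (auto simp: arcs_H doubleton_eq_iff)
    qed
    show "(if {y, z} = {?u, ?w} then s else outer {y, z}) \<noteq> (if {y', z'} = {?u, ?w} then s else outer {y', z'})"
    proof (cases "{y, z} = {?u, ?w}")
      case True
      have "f ?w = d" using f_v d by simp
      then have "f y = 0" "f z = d" using True lt f_u d by (auto simp: doubleton_eq_iff)
      then have "outer {y', z'} \<noteq> s"
        using none lt f_rng[OF V(4)] old'(1) v_f[OF V(3)] v_f[OF V(4)] by metis
      then show ?thesis using True old'(2) by simp
    next
      case False
      then have old: "(y, z) \<in> parcs G" using yz by (auto simp: arcs_H)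
      have "outer {v (x + f y), v (x + f y + (f z - f y))} \<noteq>
          outer {v (x + f y + (f y' - f y)), v (x + f y + (f z' - f y))}"
        using lt old old' f_rng[OF V(1)] f_rng[OF V(4)] v_f V
        by (intro crossing_chords) (auto simp: add.assoc)
      then show ?thesis using False old'(2) v_f V by (simp add: add.assoc)
    qed
  qed
  then show False using max nonedge uw range_v unfolding maximal_planar_def by blast
qed

lemma chords_form_maximal_book:
  assumes "maximal_planar G"
  shows "maximal_book n (\<lambda>x y. (v x, v y) \<in> parcs G) (\<lambda>x y. outer {v x, v y})"
proof unfold_locales
  have per: "v (x + n) = v x" for x by (simp add: v_eq)
  show "(v (x + n), v y) \<in> parcs G \<longleftrightarrow> (v x, v y) \<in> parcs G" for x y by (simp add: per)
  show "outer {v (x + n), v y} \<longleftrightarrow> outer {v x, v y}" for x y by (simp add: per)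
  show "(v x, v y) \<in> parcs G \<longleftrightarrow> (v y, v x) \<in> parcs G" for x y using arc_sym by blast
  show "outer {v x, v y} \<longleftrightarrow> outer {v y, v x}" for x y by (simp add: insert_commute)
  show "4 \<le> n" by (rule n_ge)
  show "(v x, v (x + 1)) \<in> parcs G" for x by (rule cycle_edge)
  show "outer {v x, v (x + d)} \<noteq> outer {v (x + a), v (x + b)}"
    if "0 < a" "a < d" "d < b" "b < n" "(v x, v (x + d)) \<in> parcs G" "(v (x + a), v (x + b)) \<in> parcs G"
    for a d b x
    using that by (rule crossing_chords)
  show "\<exists>a b. 0 < a \<and> a < d \<and> d < b \<and> b < n \<and> (v (x + a), v (x + b)) \<in> parcs G \<and>
      outer {v (x + a), v (x + b)} = s"
    if "0 < d" "d < n" "(v x, v (x + d)) \<notin> parcs G" for d x s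
    using assms that by (rule blocked_chord)
qed

end

section \<open>Two disjoint total dominating sets\<close>

lemma two_le_total_domatic_number:
  assumes "finite (pverts G)" "pverts G \<noteq> {}"
    and "total_dominating_set G S" "total_dominating_set G T" "S \<inter> T = {}"
  shows "2 \<le> total_domatic_number G"
proof -
  have "S \<noteq> T" using assms unfolding total_dominating_set_def by blast
  then have "card {S, T} = 2" by simp
  moreover have "\<forall>R \<in> {S, T}. total_dominating_set G R" "pairwise disjnt {S, T}"
    using assms by (auto simp: pairwise_def disjnt_def)
  ultimately have "2 \<in> {card F |F. (\<forall>S \<in> F. total_dominating_set G S) \<and> pairwise disjnt F}"
    by (smt (verit) mem_Collect_eq)
  moreover have "finite {card F |F. (\<forall>S \<in> F. total_dominating_set G S) \<and> pairwise disjnt F}"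
  proof (rule finite_subset)
    show "{card F |F. (\<forall>S \<in> F. total_dominating_set G S) \<and> pairwise disjnt F} \<subseteq> card ` Pow (Pow (pverts G))"
      by (auto simp: total_dominating_set_def)
  qed (use assms in simp)
  ultimately show ?thesis unfolding total_domatic_number_def by (rule Max_ge[rotated])
qed

theorem theorem3:
  fixes G :: "'a pair_pre_digraph"
  assumes "pair_graph G"
    and "maximal_planar G"
    and "hamiltonian G"
    and "card (pverts G) \<ge> 4"
  shows "total_domatic_number G \<ge> 2"
proof -
  define n where "n = int (card (pverts G))"
  have "4 \<le> n" using assms(4) by (simp add: n_def)
  obtain v where v: "\<And>x y. v x = v y \<longleftrightarrow> n dvd x - y" "range v = pverts G" "\<And>x. (v x, v (x + 1)) \<in> parcs G"
    using hamiltonian_cycle[OF assms(3)] unfolding n_def by blast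
  obtain pos \<gamma> where "plane_drawing G pos \<gamma>"
    using assms(2) unfolding maximal_planar_def planar_def by blast
  then interpret cyclic_plane_graph G n v pos \<gamma>
    by (rule cyclic_plane_graph.intro[OF assms(1) \<open>4 \<le> n\<close> v])
  have "sees_both n (\<lambda>x y. (v x, v y) \<in> parcs G)"
    using maximal_book.graph_sees_both[OF chords_form_maximal_book[OF assms(2)]] .
  then obtain c where c_per: "\<And>x. c (x + n) = c x"
    and c: "\<And>x. \<exists>y z. (v x, v y) \<in> parcs G \<and> (v x, v z) \<in> parcs G \<and> c y \<and> \<not> c z"
    unfolding sees_both_def by blast
  have c_mult: "c (x + n * k) = c x" for x k
  proof (induction k rule: int_induct[where k = 0])
    case (step1 i)
    then show ?case using c_per[of "x + n * i"] by (simp add: algebra_simps)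
  next
    case (step2 i)
    then show ?case using c_per[of "x + n * (i - 1)"] by (simp add: algebra_simps)
  qed simp
  have c_cong: "c x = c y" if "v x = v y" for x y
  proof -
    have "n dvd x - y" using \<open>v x = v y\<close> unfolding v(1) .
    then obtain k where "x - y = n * k" by (rule dvdE)
    then have "x = y + n * k" by simp
    then show ?thesis by (simp only: c_mult)
  qed
  have "total_dominating_set G (v ` {x. c x})" "total_dominating_set G (v ` {x. \<not> c x})"
    unfolding total_dominating_set_def v(2)[symmetric] using c by blast+
  moreover have "v ` {x. c x} \<inter> v ` {x. \<not> c x} = {}" using c_cong by blast
  moreover have "finite (pverts G)" "pverts G \<noteq> {}"
    using assms(4) card.infinite by fastforce+
  ultimately show ?thesis by (rule two_le_total_domatic_number[rotated 2])
qed

end
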